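(* Let $\Gamma$ be finite and let $x\in M_n(\mathcal A)$ be self-adjoint. Then the Cauchy transform $G(z)=\int_{\mathbb R}\frac{d\nu(t)}{z-t}$ of the law $\nu$ of $x$ with respect to $\mathrm{Tr}\otimes\mathrm{tr}_n$ is algebraic, i.e. its expansion as a power series in $1/z$ satisfies a nontrivial polynomial equation $\sum_{j=0}^m Q_j(1/z)G^j=0$ with polynomials $Q_j$ not all zero.
   Context: $\Gamma$ is a finite connected undirected graph (loops, multiple edges allowed), vertex set $V$, weighting $\mu:V\to(0,\infty)$. Directed version $\vec\Gamma$: each edge with distinct endpoints $\alpha\ne\beta$ yields $\epsilon,\epsilon^{op}$ with $s(\epsilon)=t(\epsilon^{op})=\alpha$, $t(\epsilon)=s(\epsilon^{op})=\beta$; each loop yields one directed loop $\epsilon=\epsilon^{op}$. $\mathcal C=C_0(V)$, $p_\alpha$ indicator of $\alpha$; $\mathcal X$ the Hilbert $\mathcal C$-$\mathcal C$ bimodule spanned by directed edges with $p_\alpha\epsilon=\delta_{s(\epsilon),\alpha}\epsilon$, $\epsilon p_\alpha=\delta_{t(\epsilon),\alpha}\epsilon$, $\langle\epsilon'|\epsilon\rangle=\delta_{\epsilon,\epsilon'}p_{t(\epsilon)}$; $\mathcal F(\mathcal X)$ its full Fock space with creation operators $\ell(\xi)$. For a loop $e$: $X_e=\ell(\epsilon)+\ell(\epsilon)^*$; for $e$ with endpoints $\alpha\ne\beta$: $a_\epsilon=(\mu(\alpha)/\mu(\beta))^{1/4}$, $X_e=a_\epsilon\ell(\epsilon)+a_\epsilon^{-1}\ell(\epsilon^{op})^*+a_\epsilon^{-1}\ell(\epsilon^{op})+a_\epsilon\ell(\epsilon)^*$;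 $X_\epsilon=p_{s(\epsilon)}X_ep_{t(\epsilon)}$. $\mathcal S(\Gamma,\mu)$ is the C$^*$-algebra generated by $\mathcal C$ and the $X_e$; $\mathrm{Tr}=\mathrm{tr}\circ E$ with $E(x)=PxP$ ($P$ projection onto $\mathcal C$), $\mathrm{tr}(p_v)=\mu(v)$ (a finite faithful trace since $\Gamma$ is finite). $\mathcal A$ is the $*$-algebra generated by $\{p_\beta\}\cup\{X_\epsilon\}$. $\mathrm{tr}_n$ is the trace on $M_n(\mathbb C)$. The law of a self-adjoint $x$ with respect to a faithful positive trace $\phi$ is the unique positive measure $\nu$ with $\phi(x^k)=\int t^k\,d\nu(t)$ for all $k\ge0$. *)

theory Defs
  imports "HOL-Analysis.Analysis" "HOL-Computational_Algebra.Polynomial_FPS"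
begin

section \<open>Finite graph: vertices V, undirected edges Ed with endpoint sets\<close>

text \<open>An undirected edge e has endpoint set ends e (one element for a loop,
two elements otherwise).  The directed version: a directed edge is a pair (e,a)
with a an endpoint of e, meaning e traversed starting at a.  For a loop there is
exactly one directed edge (e,v), and it equals its opposite.\<close>

definition graph_wf :: "'v set \<Rightarrow> 'e set \<Rightarrow> ('e \<Rightarrow> 'v set) \<Rightarrow> bool" where
  "graph_wf V Ed ends \<longleftrightarrow> finite V \<and> finite Ed \<and>
     (\<forall>e\<in>Ed. ends e \<subseteq> V \<and> (card (ends e) = 1 \<or> card (ends e) = 2))"

definition graph_connected :: "'v set \<Rightarrow> 'e set \<Rightarrow> ('e \<Rightarrow> 'v set) \<Rightarrow> bool" where
  "graph_connected V Ed ends \<longleftrightarrow> V \<noteq> {} \<and>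
     (\<forall>a\<in>V. \<forall>b\<in>V. (a, b) \<in> {(x, y). \<exists>e\<in>Ed. ends e = {x, y}}\<^sup>*)"

definition dsrc :: "'e \<times> 'v \<Rightarrow> 'v" where
  "dsrc \<epsilon> = snd \<epsilon>"

definition dtgt :: "('e \<Rightarrow> 'v set) \<Rightarrow> 'e \<times> 'v \<Rightarrow> 'v" where
  "dtgt ends \<epsilon> = (if ends (fst \<epsilon>) = {snd \<epsilon>} then snd \<epsilon>
                   else (THE b. b \<in> ends (fst \<epsilon>) \<and> b \<noteq> snd \<epsilon>))"

definition dopp :: "('e \<Rightarrow> 'v set) \<Rightarrow> 'e \<times> 'v \<Rightarrow> 'e \<times> 'v" where
  "dopp ends \<epsilon> = (fst \<epsilon>, dtgt ends \<epsilon>)"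

definition dedges :: "'e set \<Rightarrow> ('e \<Rightarrow> 'v set) \<Rightarrow> ('e \<times> 'v) set" where
  "dedges Ed ends = {(e, a). e \<in> Ed \<and> a \<in> ends e}"

section \<open>Full Fock space: basis = paths (vertex = length 0, or composable edge strings)\<close>

text \<open>A basis element of the Fock space is (v, [eps1,...,epsk]) where v is the
start vertex (v = s(eps1)) and t(eps_i) = s(eps_(i+1)); the length 0 path (v,[])
is p_v in C.\<close>

type_synonym ('v,'e) fpath = "'v \<times> ('e \<times> 'v) list"

text \<open>Operators are represented by their matrices with respect to this basis:
K w' w = coefficient of w' in K applied to w.\<close>
type_synonym ('v,'e) kern = "('v,'e) fpath \<Rightarrow> ('v,'e) fpath \<Rightarrow> complex"

fun walk_from :: "'v set \<Rightarrow> 'e set \<Rightarrow> ('e \<Rightarrow> 'v set) \<Rightarrow> 'v \<Rightarrow> ('e \<times> 'v) list \<Rightarrow> bool" where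
  "walk_from V Ed ends v [] = (v \<in> V)"
| "walk_from V Ed ends v (\<epsilon> # es) =
     (\<epsilon> \<in> dedges Ed ends \<and> dsrc \<epsilon> = v \<and> walk_from V Ed ends (dtgt ends \<epsilon>) es)"

definition valid_path :: "'v set \<Rightarrow> 'e set \<Rightarrow> ('e \<Rightarrow> 'v set) \<Rightarrow> ('v,'e) fpath \<Rightarrow> bool" where
  "valid_path V Ed ends w = walk_from V Ed ends (fst w) (snd w)"

definition kzero :: "('v,'e) kern" where "kzero = (\<lambda>w' w. 0)"

definition kadd :: "('v,'e) kern \<Rightarrow> ('v,'e) kern \<Rightarrow> ('v,'e) kern" where
  "kadd K L = (\<lambda>w' w. K w' w + L w' w)"

definition ksmul :: "complex \<Rightarrow> ('v,'e) kern \<Rightarrow> ('v,'e) kern" where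
  "ksmul c K = (\<lambda>w' w. c * K w' w)"

definition kmult :: "('v,'e) kern \<Rightarrow> ('v,'e) kern \<Rightarrow> ('v,'e) kern" where
  "kmult K L = (\<lambda>w' w. \<Sum>\<^sub>\<infinity>u. K w' u * L u w)"

definition kadj :: "('v,'e) kern \<Rightarrow> ('v,'e) kern" where
  "kadj K = (\<lambda>w' w. cnj (K w w'))"

text \<open>identity operator of the Fock space\<close>
definition kid :: "'v set \<Rightarrow> 'e set \<Rightarrow> ('e \<Rightarrow> 'v set) \<Rightarrow> ('v,'e) kern" where
  "kid V Ed ends = (\<lambda>w' w. if valid_path V Ed ends w \<and> w' = w then 1 else 0)"

text \<open>p_beta acting on the left\<close>
definition kproj :: "'v set \<Rightarrow> 'e set \<Rightarrow> ('e \<Rightarrow> 'v set) \<Rightarrow> 'v \<Rightarrow> ('v,'e) kern" where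
  "kproj V Ed ends \<beta> = (\<lambda>w' w. if valid_path V Ed ends w \<and> fst w = \<beta> \<and> w' = w then 1 else 0)"

text \<open>creation operator l(eps): w \<mapsto> eps \<otimes> w (zero unless t(eps) = start of w)\<close>
definition kcreat :: "'v set \<Rightarrow> 'e set \<Rightarrow> ('e \<Rightarrow> 'v set) \<Rightarrow> 'e \<times> 'v \<Rightarrow> ('v,'e) kern" where
  "kcreat V Ed ends \<epsilon> = (\<lambda>w' w. if valid_path V Ed ends w \<and> fst w = dtgt ends \<epsilon>
        \<and> w' = (dsrc \<epsilon>, \<epsilon> # snd w) then 1 else 0)"

definition acoef :: "('v \<Rightarrow> real) \<Rightarrow> ('e \<Rightarrow> 'v set) \<Rightarrow> 'e \<times> 'v \<Rightarrow> complex" where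
  "acoef \<mu> ends \<epsilon> = complex_of_real ((\<mu> (dsrc \<epsilon>) / \<mu> (dtgt ends \<epsilon>)) powr (1/4))"

text \<open>X_e for an undirected edge e (independent of the chosen orientation)\<close>
definition Xund :: "'v set \<Rightarrow> 'e set \<Rightarrow> ('e \<Rightarrow> 'v set) \<Rightarrow> ('v \<Rightarrow> real) \<Rightarrow> 'e \<Rightarrow> ('v,'e) kern" where
  "Xund V Ed ends \<mu> e =
     (let a = (SOME a. a \<in> ends e); \<epsilon> = (e, a); l = kcreat V Ed ends;
          c = acoef \<mu> ends \<epsilon> in
      if ends e = {a} then kadd (l \<epsilon>) (kadj (l \<epsilon>))
      else kadd (kadd (ksmul c (l \<epsilon>)) (ksmul (inverse c) (kadj (l (dopp ends \<epsilon>)))))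
                (kadd (ksmul (inverse c) (l (dopp ends \<epsilon>))) (ksmul c (kadj (l \<epsilon>)))))"

text \<open>X_eps = p_{s(eps)} X_e p_{t(eps)}\<close>
definition Xdir :: "'v set \<Rightarrow> 'e set \<Rightarrow> ('e \<Rightarrow> 'v set) \<Rightarrow> ('v \<Rightarrow> real) \<Rightarrow> 'e \<times> 'v \<Rightarrow> ('v,'e) kern" where
  "Xdir V Ed ends \<mu> \<epsilon> =
     kmult (kproj V Ed ends (dsrc \<epsilon>)) (kmult (Xund V Ed ends \<mu> (fst \<epsilon>)) (kproj V Ed ends (dtgt ends \<epsilon>)))"

text \<open>The *-algebra A generated by the p_beta and the X_eps (complex coefficients)\<close>
inductive_set Aalg :: "'v set \<Rightarrow> 'e set \<Rightarrow> ('e \<Rightarrow> 'v set) \<Rightarrow> ('v \<Rightarrow> real) \<Rightarrow> ('v,'e) kern set"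
  for V Ed ends \<mu> where
  gen_p: "\<beta> \<in> V \<Longrightarrow> kproj V Ed ends \<beta> \<in> Aalg V Ed ends \<mu>"
| gen_X: "\<epsilon> \<in> dedges Ed ends \<Longrightarrow> Xdir V Ed ends \<mu> \<epsilon> \<in> Aalg V Ed ends \<mu>"
| add: "K \<in> Aalg V Ed ends \<mu> \<Longrightarrow> L \<in> Aalg V Ed ends \<mu> \<Longrightarrow> kadd K L \<in> Aalg V Ed ends \<mu>"
| smul: "K \<in> Aalg V Ed ends \<mu> \<Longrightarrow> ksmul c K \<in> Aalg V Ed ends \<mu>"
| mult: "K \<in> Aalg V Ed ends \<mu> \<Longrightarrow> L \<in> Aalg V Ed ends \<mu> \<Longrightarrow> kmult K L \<in> Aalg V Ed ends \<mu>"
| adj: "K \<in> Aalg V Ed ends \<mu> \<Longrightarrow> kadj K \<in> Aalg V Ed ends \<mu>"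

text \<open>Tr = tr o E, E(x) = PxP, tr(p_v) = mu(v)\<close>
definition Trace :: "'v set \<Rightarrow> ('v \<Rightarrow> real) \<Rightarrow> ('v,'e) kern \<Rightarrow> complex" where
  "Trace V \<mu> K = (\<Sum>v\<in>V. complex_of_real (\<mu> v) * K (v, []) (v, []))"

section \<open>n x n matrices over the algebra (indices i, j < n)\<close>

definition mat_mult :: "nat \<Rightarrow> (nat \<Rightarrow> nat \<Rightarrow> ('v,'e) kern) \<Rightarrow> (nat \<Rightarrow> nat \<Rightarrow> ('v,'e) kern)
    \<Rightarrow> (nat \<Rightarrow> nat \<Rightarrow> ('v,'e) kern)" where
  "mat_mult n A B = (\<lambda>i j. \<lambda>w' w. \<Sum>k<n. kmult (A i k) (B k j) w' w)"

definition mat_one :: "'v set \<Rightarrow> 'e set \<Rightarrow> ('e \<Rightarrow> 'v set) \<Rightarrow> nat \<Rightarrow> nat \<Rightarrow> ('v,'e) kern" where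
  "mat_one V Ed ends = (\<lambda>i j. if i = j then kid V Ed ends else kzero)"

fun mat_pow :: "'v set \<Rightarrow> 'e set \<Rightarrow> ('e \<Rightarrow> 'v set) \<Rightarrow> nat \<Rightarrow> (nat \<Rightarrow> nat \<Rightarrow> ('v,'e) kern)
    \<Rightarrow> nat \<Rightarrow> (nat \<Rightarrow> nat \<Rightarrow> ('v,'e) kern)" where
  "mat_pow V Ed ends n x 0 = mat_one V Ed ends"
| "mat_pow V Ed ends n x (Suc k) = mat_mult n x (mat_pow V Ed ends n x k)"

text \<open>k-th moment of x w.r.t. Tr \<otimes> tr_n (tr_n normalized: (1/n) times the matrix trace)\<close>
definition moment :: "'v set \<Rightarrow> 'e set \<Rightarrow> ('e \<Rightarrow> 'v set) \<Rightarrow> ('v \<Rightarrow> real) \<Rightarrow> nat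
    \<Rightarrow> (nat \<Rightarrow> nat \<Rightarrow> ('v,'e) kern) \<Rightarrow> nat \<Rightarrow> complex" where
  "moment V Ed ends \<mu> n x k = (1 / of_nat n) * (\<Sum>i<n. Trace V \<mu> (mat_pow V Ed ends n x k i i))"

text \<open>Cauchy transform G(z) = sum_k m_k z^{-(k+1)} as a formal power series in w = 1/z\<close>
definition cauchy_fps :: "(nat \<Rightarrow> complex) \<Rightarrow> complex fps" where
  "cauchy_fps m = Abs_fps (\<lambda>k. if k = 0 then 0 else m (k - 1))"

definition algebraic_fps :: "complex fps \<Rightarrow> bool" where
  "algebraic_fps G \<longleftrightarrow> (\<exists>(Q :: nat \<Rightarrow> complex poly) m. (\<exists>j\<le>m. Q j \<noteq> 0) \<and>
      (\<Sum>j\<le>m. fps_of_poly (Q j) * G ^ j) = 0)"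

end

theory Submission
  imports Defs
begin

text \<open>
  An element of the algebra is a polynomial in creation and annihilation operators, so as a matrix
  indexed by paths it only rewrites a bounded prefix of a path. The powers of \<open>x\<close> therefore count
  weighted walks of a pushdown system whose stack is the path, and the moments count the walks
  between short stacks. Cutting a walk at the moments when the stack first loses its current top
  block shows that the generating functions of the walks between short stacks, together with finitely
  many first-passage generating functions, form a finite family in which every member is a constant
  plus \<open>1/z\<close> times a quadratic form in the family. The solutions of such systems are algebraic.
\<close>

section \<open>Algebraicity of solutions of quadratic systems\<close>

text \<open>Two obstacles shape the proof. A quadratic system can have infinitely many solutions
  over an algebraic closure of the rational functions in X, so elimination may degenerate even
  though the power series solution is unique. A deformation whose leading terms are pure cubes
  leaves only finitely many irreducible monomials, and the parameter is set to zero only after a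
  relation has been found. The second obstacle is that stacks are unbounded. If a step rewrites at
  most the top \<open>N\<close> symbols, a stack of height between \<open>N\<close> and
  \<open>2 * N\<close> is cut below its top \<open>N\<close> symbols: one step lifts this block to
  height at most \<open>2 * N\<close>, and once the block is shorter than \<open>N\<close> it sits
  on at most \<open>N\<close> symbols left over. So heights up to \<open>2 * N\<close> already give
  a closed family. The series 1 belongs to it so that linear terms count as quadratic ones.\<close>

lemma linear_dependence_idom:
  fixes r :: "'i \<Rightarrow> 'b \<Rightarrow> 'a::idom"
  assumes "finite B" "finite I" "card B < card I"
  shows "\<exists>q. (\<exists>i\<in>I. q i \<noteq> 0) \<and> (\<forall>b\<in>B. (\<Sum>i\<in>I. q i * r i b) = 0)"
  using assms
proof (induction B arbitrary: I r rule: finite_induct)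
  case empty
  then obtain i where "i \<in> I"
    by fastforce
  then show ?case
    by (intro exI[of _ "\<lambda>_. 1"]) auto
next
  case (insert b B)
  show ?case
  proof (cases "\<exists>p\<in>I. r p b \<noteq> 0")
    case False
    have "card B < card I"
      using insert by simp
    then obtain q where "\<exists>i\<in>I. q i \<noteq> 0" "\<forall>b\<in>B. (\<Sum>i\<in>I. q i * r i b) = 0"
      using insert.IH insert.prems by blast
    then show ?thesis
      using False by (intro exI[of _ q]) auto
  next
    case True
    then obtain p where p: "p \<in> I" "r p b \<noteq> 0"
      by blast
    \<comment> \<open>Fraction-free elimination: cross-multiplication with the pivot
      \<open>r p b\<close> makes coordinate \<open>b\<close> vanish on the remaining vectors without
      any division.\<close>
    let ?r = "\<lambda>i c. r p b * r i c - r i b * r p c"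
    have "card B < card (I - {p})"
      using insert p by simp
    then obtain q where q: "\<exists>i\<in>I - {p}. q i \<noteq> 0"
        "\<forall>c\<in>B. (\<Sum>i\<in>I - {p}. q i * ?r i c) = 0"
      using insert.IH[of "I - {p}" ?r] insert.prems by blast
    define q' where "q' i = (if i = p then - (\<Sum>i\<in>I - {p}. q i * r i b) else r p b * q i)" for i
    have sum: "(\<Sum>i\<in>I. q' i * r i c) = (\<Sum>i\<in>I - {p}. q i * ?r i c)" for c
    proof -
      have "(\<Sum>i\<in>I. q' i * r i c) = q' p * r p c + (\<Sum>i\<in>I - {p}. q' i * r i c)"
        using p insert.prems by (simp add: sum.remove)
      also have "(\<Sum>i\<in>I - {p}. q' i * r i c) = (\<Sum>i\<in>I - {p}. r p b * q i * r i c)"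
        by (intro sum.cong) (auto simp: q'_def)
      also have "q' p * r p c = (\<Sum>i\<in>I - {p}. - (q i * r i b * r p c))"
        by (simp add: q'_def sum_distrib_right sum_negf)
      finally show ?thesis
        by (simp add: sum.distrib[symmetric] algebra_simps)
    qed
    show ?thesis
    proof (intro exI[of _ q'] conjI ballI)
      show "\<exists>i\<in>I. q' i \<noteq> 0"
        using q(1) p by (auto simp: q'_def)
      fix c assume "c \<in> insert b B"
      then show "(\<Sum>i\<in>I. q' i * r i c) = 0"
        unfolding sum using q(2) by (auto simp: mult.commute)
    qed
  qed
qed

section \<open>Congruence modulo powers of X, and fixed points\<close>

definition fps_agree :: "nat \<Rightarrow> 'a fps \<Rightarrow> 'a fps \<Rightarrow> bool" where
  "fps_agree n f g \<longleftrightarrow> (\<forall>k<n. fps_nth f k = fps_nth g k)"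

lemma fps_agree_mult:
  assumes "fps_agree n f f'" "fps_agree n g g'"
  shows "fps_agree n (f * g) (f' * g' :: 'a::comm_semiring_1 fps)"
  using assms unfolding fps_agree_def fps_mult_nth by (auto intro!: sum.cong)

lemma fps_agree_add:
  assumes "fps_agree n f f'" "fps_agree n g g'"
  shows "fps_agree n (f + g) (f' + g' :: 'a::comm_semiring_1 fps)"
  using assms unfolding fps_agree_def by auto

lemma fps_agree_sum:
  assumes "\<And>i. i \<in> I \<Longrightarrow> fps_agree n (f i) (g i)"
  shows "fps_agree n (\<Sum>i\<in>I. f i) (\<Sum>i\<in>I. g i :: 'a::comm_semiring_1 fps)"
  using assms unfolding fps_agree_def fps_sum_nth by auto

lemma fps_agree_power:
  assumes "fps_agree n f g"
  shows "fps_agree n (f ^ m) (g ^ m :: 'a::comm_semiring_1 fps)"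
  by (induction m) (auto intro!: fps_agree_mult assms, auto simp: fps_agree_def)

lemma fps_agree_X_mult:
  assumes "fps_agree n f g"
  shows "fps_agree (Suc n) (fps_X * f) (fps_X * g :: 'a::comm_semiring_1 fps)"
  using assms unfolding fps_agree_def by auto

lemma fps_agree_refl [simp]: "fps_agree n f f"
  by (simp add: fps_agree_def)

lemma fps_eqI_agree: "(\<And>n. fps_agree n f g) \<Longrightarrow> f = g"
  unfolding fps_agree_def fps_eq_iff by blast

text \<open>Banach's fixed point theorem for the X-adic metric: each application of \<open>F\<close>
  gains one correct coefficient, so the iterates started at 0 stabilise coefficientwise.\<close>

lemma fps_contraction_fixpoint:
  fixes F :: "('j \<Rightarrow> 'a::comm_semiring_1 fps) \<Rightarrow> 'j \<Rightarrow> 'a fps"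
  assumes contr: "\<And>n f g. (\<And>j. fps_agree n (f j) (g j)) \<Longrightarrow> (\<And>j. fps_agree (Suc n) (F f j) (F g j))"
  shows "\<exists>f. \<forall>j. f j = F f j"
proof -
  define it where "it m = (F ^^ m) (\<lambda>_. 0)" for m
  have step: "fps_agree m (it m j) (it (Suc m) j)" for m j
  proof (induction m arbitrary: j)
    case (Suc m)
    then show ?case
      using contr[of m "it m" "it (Suc m)"] by (simp add: it_def)
  qed (simp add: fps_agree_def)
  have stable: "fps_nth (it (m + d) j) k = fps_nth (it m j) k" if "k < m" for m d j k
  proof (induction d)
    case (Suc d)
    then show ?case
      using step[of "m + d" j] that unfolding fps_agree_def by simp
  qed simp
  \<comment> \<open>Coefficient \<open>k\<close> is stable from iterate \<open>Suc k\<close> on, so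
    this diagonal is the limit.\<close>
  define f where "f j = Abs_fps (\<lambda>k. fps_nth (it (Suc k) j) k)" for j
  have agree: "fps_agree m (f j) (it m j)" for m j
    unfolding fps_agree_def
  proof (intro allI impI)
    fix k assume "k < m"
    then show "fps_nth (f j) k = fps_nth (it m j) k"
      using stable[of k "Suc k" "m - Suc k" j] by (simp add: f_def)
  qed
  have "f j = F f j" for j
  proof (rule fps_eqI_agree)
    fix n
    have "fps_agree (Suc n) (F f j) (F (it n) j)"
      by (intro contr agree)
    then show "fps_agree n (f j) (F f j)"
      using agree[of "Suc n" j] by (auto simp: fps_agree_def it_def)
  qed
  then show ?thesis
    by blast
qed

section \<open>Modules over the polynomials, up to powers of a fixed polynomial\<close>

definition poly_span :: "'a::idom fps set \<Rightarrow> 'a fps set" where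
  "poly_span B = {\<Sum>b\<in>B. fps_of_poly (r b) * b | r. True}"

lemma poly_span_add:
  assumes "f \<in> poly_span B" "g \<in> poly_span B"
  shows "f + g \<in> poly_span B"
proof -
  obtain r r' where "f = (\<Sum>b\<in>B. fps_of_poly (r b) * b)" "g = (\<Sum>b\<in>B. fps_of_poly (r' b) * b)"
    using assms unfolding poly_span_def by blast
  then have "f + g = (\<Sum>b\<in>B. fps_of_poly (r b + r' b) * b)"
    by (simp add: fps_of_poly_add algebra_simps sum.distrib)
  then show ?thesis
    unfolding poly_span_def mem_Collect_eq by (intro exI[of _ "\<lambda>b. r b + r' b"]) simp
qed

lemma poly_span_scale:
  assumes "f \<in> poly_span B"
  shows "fps_of_poly p * f \<in> poly_span B"
proof -
  obtain r where "f = (\<Sum>b\<in>B. fps_of_poly (r b) * b)"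
    using assms unfolding poly_span_def by blast
  then have "fps_of_poly p * f = (\<Sum>b\<in>B. fps_of_poly (p * r b) * b)"
    by (simp add: fps_of_poly_mult mult.assoc sum_distrib_left)
  then show ?thesis
    unfolding poly_span_def mem_Collect_eq by (intro exI[of _ "\<lambda>b. p * r b"]) simp
qed

lemma poly_span_base:
  assumes "finite B" "f \<in> B"
  shows "f \<in> poly_span B"
proof -
  have "f = (\<Sum>b\<in>B. if b = f then b else 0)"
    using assms by (simp add: sum.delta)
  also have "\<dots> = (\<Sum>b\<in>B. fps_of_poly (if b = f then 1 else 0) * b)"
    by (intro sum.cong) auto
  finally show ?thesis
    unfolding poly_span_def mem_Collect_eq by (intro exI[of _ "\<lambda>b. if b = f then 1 else 0"]) simp
qed

text \<open>These series fall into the span of \<open>B\<close> once \<open>s\<close> is inverted.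
  The cubic equations determine a cube only up to the factor \<open>s\<close>, so a reduction costs
  powers of \<open>s\<close>.\<close>

definition sat_span :: "'a::idom poly \<Rightarrow> 'a fps set \<Rightarrow> 'a fps set" where
  "sat_span s B = {f. \<exists>k. fps_of_poly (s ^ k) * f \<in> poly_span B}"

lemma sat_span_add:
  assumes "f \<in> sat_span s B" "g \<in> sat_span s B"
  shows "f + g \<in> sat_span s B"
proof -
  obtain k l where "fps_of_poly (s ^ k) * f \<in> poly_span B" "fps_of_poly (s ^ l) * g \<in> poly_span B"
    using assms unfolding sat_span_def by blast
  then have "fps_of_poly (s ^ l) * (fps_of_poly (s ^ k) * f) +
      fps_of_poly (s ^ k) * (fps_of_poly (s ^ l) * g) \<in> poly_span B"
    by (intro poly_span_add[OF poly_span_scale poly_span_scale])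
  then show ?thesis
    unfolding sat_span_def mem_Collect_eq
    by (intro exI[of _ "k + l"]) (simp add: fps_of_poly_mult power_add algebra_simps)
qed

lemma sat_span_scale:
  assumes "f \<in> sat_span s B"
  shows "fps_of_poly p * f \<in> sat_span s B"
proof -
  obtain k where "fps_of_poly (s ^ k) * f \<in> poly_span B"
    using assms unfolding sat_span_def by blast
  then have "fps_of_poly p * (fps_of_poly (s ^ k) * f) \<in> poly_span B"
    by (rule poly_span_scale)
  then show ?thesis
    unfolding sat_span_def mem_Collect_eq by (intro exI[of _ k]) (simp add: mult.left_commute)
qed

lemma sat_span_diff:
  assumes "f \<in> sat_span s B" "g \<in> sat_span s B"
  shows "f - g \<in> sat_span s B"
  using sat_span_add[OF assms(1) sat_span_scale[OF assms(2), of "-1"]]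
  by (simp add: fps_of_poly_uminus)

lemma sat_span_base: "finite B \<Longrightarrow> f \<in> B \<Longrightarrow> f \<in> sat_span s B"
  unfolding sat_span_def mem_Collect_eq by (intro exI[of _ 0]) (simp add: poly_span_base)

lemma sat_span_sum:
  fixes f :: "'i \<Rightarrow> 'a::idom fps"
  assumes "finite I" "\<And>i. i \<in> I \<Longrightarrow> f i \<in> sat_span s B"
  shows "(\<Sum>i\<in>I. f i) \<in> sat_span s B"
  using assms
proof (induction I rule: finite_induct)
  case empty
  have "(0 :: 'a fps) \<in> poly_span B"
    unfolding poly_span_def mem_Collect_eq by (intro exI[of _ "\<lambda>_. 0"]) simp
  then show ?case
    unfolding sat_span_def by simp
qed (auto intro: sat_span_add)

lemma sat_span_cancel:
  assumes "fps_of_poly s * f \<in> sat_span s B"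
  shows "f \<in> sat_span s B"
proof -
  obtain k where "fps_of_poly (s ^ k) * (fps_of_poly s * f) \<in> poly_span B"
    using assms unfolding sat_span_def by blast
  then show ?thesis
    unfolding sat_span_def mem_Collect_eq
    by (intro exI[of _ "Suc k"]) (simp add: fps_of_poly_mult algebra_simps)
qed

lemma sat_span_common_power:
  assumes "finite I" "\<And>i. i \<in> I \<Longrightarrow> f i \<in> sat_span s B"
  shows "\<exists>k. \<forall>i\<in>I. fps_of_poly (s ^ k) * f i \<in> poly_span B"
proof -
  obtain k where k: "\<And>i. i \<in> I \<Longrightarrow> fps_of_poly (s ^ k i) * f i \<in> poly_span B"
    using assms unfolding sat_span_def mem_Collect_eq by metis
  have "fps_of_poly (s ^ sum k I) * f i \<in> poly_span B" if "i \<in> I" for i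
  proof -
    have "fps_of_poly (s ^ (sum k (I - {i}))) * (fps_of_poly (s ^ k i) * f i) \<in> poly_span B"
      by (intro poly_span_scale k that)
    moreover have "sum k I = sum k (I - {i}) + k i"
      using assms(1) that by (simp add: sum.remove)
    ultimately show ?thesis
      by (simp add: power_add fps_of_poly_mult mult.assoc)
  qed
  then show ?thesis
    by blast
qed

text \<open>After multiplication by one common power of \<open>s\<close>, the
  \<open>card B + 1\<close> powers of \<open>f\<close> with exponent at most \<open>card B\<close>
  are combinations of \<open>card B\<close> generators, hence linearly dependent. The power of
  \<open>s\<close> cancels because power series over a domain form a domain.\<close>

lemma algebraic_of_powers_in_sat_span:
  fixes f :: "'a::idom fps"
  assumes "finite B" "s \<noteq> 0" "\<And>n. f ^ n \<in> sat_span s B"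
  shows "\<exists>q m. (\<exists>j\<le>m. q j \<noteq> 0) \<and> (\<Sum>j\<le>m. fps_of_poly (q j) * f ^ j) = 0"
proof -
  obtain k where "\<forall>j\<in>{..card B}. fps_of_poly (s ^ k) * f ^ j \<in> poly_span B"
    using sat_span_common_power[of "{..card B}" "\<lambda>j. f ^ j" s B] assms by auto
  then obtain r where r: "\<And>j. j \<le> card B \<Longrightarrow>
      fps_of_poly (s ^ k) * f ^ j = (\<Sum>b\<in>B. fps_of_poly (r j b) * b)"
    unfolding poly_span_def mem_Collect_eq atMost_iff Ball_def by metis
  obtain q where q: "\<exists>j\<le>card B. q j \<noteq> 0" "\<And>b. b \<in> B \<Longrightarrow> (\<Sum>j\<le>card B. q j * r j b) = 0"
    using linear_dependence_idom[of B "{..card B}" r] assms(1) by auto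
  have "fps_of_poly (s ^ k) * (\<Sum>j\<le>card B. fps_of_poly (q j) * f ^ j) =
      (\<Sum>j\<le>card B. fps_of_poly (q j) * (\<Sum>b\<in>B. fps_of_poly (r j b) * b))"
    unfolding sum_distrib_left[of _ _ "{..card B}"]
    by (intro sum.cong refl) (simp add: r[symmetric] mult.left_commute)
  also have "\<dots> = (\<Sum>b\<in>B. fps_of_poly (\<Sum>j\<le>card B. q j * r j b) * b)"
    unfolding sum_distrib_left fps_of_poly_sum sum_distrib_right
    by (subst sum.swap) (simp add: fps_of_poly_mult mult_ac)
  also have "\<dots> = 0"
    by (simp add: q(2))
  finally have "(\<Sum>j\<le>card B. fps_of_poly (q j) * f ^ j) = 0"
    using assms(2) by (metis fps_of_poly_0 fps_of_poly_eq_iff mult_eq_0_iff power_not_zero)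
  then show ?thesis
    using q(1) by blast
qed

text \<open>Degree reduction: a monomial of degree above \<open>2 * card J\<close> contains some
  variable three times by the pigeonhole principle, and the equation of that variable trades its
  cube, at the cost of a factor \<open>s\<close>, for terms of degree at most two. Multisets play
  the role of monomials.\<close>

lemma cubic_system_monomial_reduction:
  fixes y :: "'j \<Rightarrow> 'a::idom fps"
  assumes "finite J"
    and cubic: "\<And>j. j \<in> J \<Longrightarrow> fps_of_poly s * y j ^ 3 =
      y j - fps_of_poly (c j) - (\<Sum>k\<in>J. \<Sum>l\<in>J. fps_of_poly (b j k l) * (y k * y l))"
    and "set_mset M \<subseteq> J"
  defines "B \<equiv> (\<lambda>M. \<Prod>j\<in>#M. y j) ` {M. set_mset M \<subseteq> J \<and> size M \<le> 2 * card J}"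
  shows "finite B \<and> (\<Prod>j\<in>#M. y j) \<in> sat_span s B"
proof
  have "{M. set_mset M \<subseteq> J \<and> size M \<le> 2 * card J} = (\<Union>n\<le>2 * card J. multisets_of_size J n)"
    by (auto simp: multisets_of_size_def)
  then show fin: "finite B"
    unfolding B_def using \<open>finite J\<close> by auto
  show "(\<Prod>j\<in>#M. y j) \<in> sat_span s B"
    using \<open>set_mset M \<subseteq> J\<close>
  proof (induction M rule: measure_induct_rule[of size])
    case (less M)
    show ?case
    proof (cases "size M \<le> 2 * card J")
      case True
      then show ?thesis
        using less.prems by (intro sat_span_base fin) (auto simp: B_def)
    next
      case False
      have "\<exists>i. 3 \<le> count M i"
      proof (rule ccontr)
        assume neg: "\<not> ?thesis"
        have "count M i \<le> 2" for i
        proof -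
          have "\<not> 3 \<le> count M i"
            using neg by blast
          then show ?thesis
            by linarith
        qed
        then have "size M \<le> (\<Sum>i\<in>set_mset M. 2)"
          unfolding size_multiset_overloaded_eq by (intro sum_mono)
        also have "\<dots> \<le> 2 * card J"
          using card_mono[OF \<open>finite J\<close> less.prems] by simp
        finally show False
          using False by simp
      qed
      then obtain i where i: "3 \<le> count M i"
        by blast
      define L where "L = M - {#i, i, i#}"
      have M: "M = L + {#i, i, i#}"
        using i unfolding L_def by (intro multiset_eqI) auto
      have "i \<in> J" and LJ: "set_mset L \<subseteq> J"
        using less.prems M by auto
      \<comment> \<open>The terms replacing the cube correspond to \<open>N\<close> being
        \<open>{#i#}\<close>, \<open>{#}\<close> or \<open>{#k, l#}\<close>, all of size below
        three.\<close>
      have small: "(\<Prod>j\<in>#N. y j) * (\<Prod>j\<in>#L. y j) \<in> sat_span s B" if "set_mset N \<subseteq> J" "size N < 3" for N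
        using less.IH[of "N + L"] that LJ by (simp add: M)
      have "fps_of_poly s * (\<Prod>j\<in>#M. y j) = (fps_of_poly s * y i ^ 3) * (\<Prod>j\<in>#L. y j)"
        unfolding M by (simp add: power3_eq_cube mult_ac)
      also have "\<dots> = (\<Prod>j\<in>#{#i#}. y j) * (\<Prod>j\<in>#L. y j)
          - fps_of_poly (c i) * ((\<Prod>j\<in>#{#}. y j) * (\<Prod>j\<in>#L. y j))
          - (\<Sum>k\<in>J. \<Sum>l\<in>J. fps_of_poly (b i k l) * ((\<Prod>j\<in>#{#k, l#}. y j) * (\<Prod>j\<in>#L. y j)))"
        unfolding cubic[OF \<open>i \<in> J\<close>] by (simp add: algebra_simps sum_distrib_left)
      also have "\<dots> \<in> sat_span s B"
        using \<open>i \<in> J\<close> \<open>finite J\<close>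
        by (intro sat_span_diff sat_span_sum sat_span_scale small) auto
      finally show ?thesis
        by (rule sat_span_cancel)
    qed
  qed
qed

lemma cubic_system_algebraic:
  fixes y :: "'j \<Rightarrow> 'a::idom fps"
  assumes "finite J" "s \<noteq> 0"
    and "\<And>j. j \<in> J \<Longrightarrow> fps_of_poly s * y j ^ 3 =
      y j - fps_of_poly (c j) - (\<Sum>k\<in>J. \<Sum>l\<in>J. fps_of_poly (b j k l) * (y k * y l))"
    and "i \<in> J"
  shows "\<exists>q m. (\<exists>j\<le>m. q j \<noteq> 0) \<and> (\<Sum>j\<le>m. fps_of_poly (q j) * y i ^ j) = 0"
proof -
  define B where "B = (\<lambda>M. \<Prod>j\<in>#M. y j) ` {M. set_mset M \<subseteq> J \<and> size M \<le> 2 * card J}"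
  have red: "finite B \<and> (\<Prod>j\<in>#M. y j) \<in> sat_span s B" if "set_mset M \<subseteq> J" for M
    unfolding B_def by (rule cubic_system_monomial_reduction) (use assms that in auto)
  show ?thesis
  proof (rule algebraic_of_powers_in_sat_span)
    show "finite B"
      using red[of "{#}"] by simp
    show "y i ^ n \<in> sat_span s B" for n
      using red[of "replicate_mset n i"] \<open>i \<in> J\<close> by (cases "n = 0") auto
  qed (fact assms(2))
qed

section \<open>Power series over the polynomials in a parameter t, specialised at t = 0\<close>

definition fps_eval0 :: "'a::comm_semiring_1 poly fps \<Rightarrow> 'a fps" where
  "fps_eval0 f = Abs_fps (\<lambda>n. poly (fps_nth f n) 0)"

lemma fps_eval0_nth [simp]: "fps_nth (fps_eval0 f) n = poly (fps_nth f n) 0"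
  by (simp add: fps_eval0_def)

lemma fps_eval0_add: "fps_eval0 (f + g) = fps_eval0 f + fps_eval0 g"
  by (simp add: fps_eq_iff)

lemma fps_eval0_mult: "fps_eval0 (f * g) = fps_eval0 f * fps_eval0 g"
  by (simp add: fps_eq_iff fps_mult_nth poly_sum)

lemma fps_eval0_const: "fps_eval0 (fps_const c) = fps_const (poly c 0)"
  by (simp add: fps_eq_iff)

lemma fps_eval0_X: "fps_eval0 fps_X = fps_X"
  by (simp add: fps_eq_iff fps_X_def)

lemma fps_eval0_sum: "fps_eval0 (\<Sum>i\<in>I. f i) = (\<Sum>i\<in>I. fps_eval0 (f i))"
  by (simp add: fps_eq_iff fps_sum_nth poly_sum)

lemma fps_eval0_power: "fps_eval0 (f ^ n) = fps_eval0 f ^ n"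
proof (induction n)
  case 0
  show ?case
    using fps_eval0_const[of 1] by simp
qed (simp add: fps_eval0_mult)

lemma fps_eval0_fps_of_poly:
  "fps_eval0 (fps_of_poly p) = fps_of_poly (map_poly (\<lambda>c. poly c 0) p)"
  by (simp add: fps_eq_iff coeff_map_poly)

text \<open>Specialisation may make the relation trivial. Then all its coefficients are divisible by
  t, and dividing by t lowers the t-degree of a chosen nonzero coefficient, so this can happen only
  finitely often.\<close>

lemma algebraic_eval0:
  fixes f :: "'a::idom poly fps"
  assumes "\<exists>j\<le>m. q j \<noteq> 0" "(\<Sum>j\<le>m. fps_of_poly (q j) * f ^ j) = 0"
  shows "\<exists>Q. (\<exists>j\<le>m. Q j \<noteq> 0) \<and> (\<Sum>j\<le>m. fps_of_poly (Q j) * fps_eval0 f ^ j) = 0"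
proof -
  obtain j i where j: "j \<le> m" "coeff (q j) i \<noteq> 0"
    using assms(1) by (auto simp: poly_eq_iff)
  then show ?thesis
    using assms(2)
  proof (induction "degree (coeff (q j) i)" arbitrary: q rule: less_induct)
    case less
    define Q where "Q l = map_poly (\<lambda>c. poly c 0) (q l)" for l
    show ?case
    proof (cases "\<exists>l\<le>m. Q l \<noteq> 0")
      case True
      have "(\<Sum>l\<le>m. fps_of_poly (Q l) * fps_eval0 f ^ l)
          = fps_eval0 (\<Sum>l\<le>m. fps_of_poly (q l) * f ^ l)"
        by (simp add: Q_def fps_eval0_sum fps_eval0_mult fps_eval0_power fps_eval0_fps_of_poly)
      also have "\<dots> = 0"
        unfolding less.prems by (simp add: fps_eq_iff)
      finally show ?thesis
        using True by blast
    next
      case False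
      \<comment> \<open>Shifting by one drops the constant term, which is zero here, and so divides
        by t.\<close>
      define q' where "q' l = map_poly (poly_shift 1) (q l)" for l
      have coeff_q': "coeff (q l) k = pCons 0 (coeff (q' l) k)" if "l \<le> m" for l k
      proof -
        have "poly (coeff (q l) k) 0 = 0"
          using False that by (metis Q_def coeff_0 coeff_map_poly poly_0)
        then show ?thesis
          by (simp add: q'_def coeff_map_poly poly_eq_iff coeff_poly_shift coeff_pCons poly_0_coeff_0
              split: nat.split)
      qed
      have q: "fps_of_poly (q l) = fps_const [:0, 1:] * fps_of_poly (q' l)" if "l \<le> m" for l
        using coeff_q'[OF that] by (simp add: fps_eq_iff)
      have "fps_const [:0, 1:] * (\<Sum>l\<le>m. fps_of_poly (q' l) * f ^ l) = 0"
        using less.prems(3) by (simp add: q sum_distrib_left mult.assoc)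
      then have "(\<Sum>l\<le>m. fps_of_poly (q' l) * f ^ l) = 0"
        by simp
      moreover have "coeff (q' j) i \<noteq> 0" "degree (coeff (q' j) i) < degree (coeff (q j) i)"
        using less.prems coeff_q'[of j i] by auto
      ultimately show ?thesis
        using less.hyps less.prems by blast
    qed
  qed
qed

text \<open>
  Adding \<open>t X y\<^sub>j\<^sup>3\<close> to the \<open>j\<close>-th equation of the system makes all sufficiently large monomials
  reducible over the polynomials in \<open>t\<close> and \<open>X\<close>, so the solution of the deformed system is algebraic
  for dimension reasons; at \<open>t = 0\<close> it specialises to \<open>y\<close>.
\<close>
theorem quadratic_system_algebraic:
  fixes y :: "'j \<Rightarrow> 'a::idom fps"
  assumes "finite J"
    and system: "\<And>j. j \<in> J \<Longrightarrow> y j =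
      fps_const (c j) + fps_X * (\<Sum>k\<in>J. \<Sum>l\<in>J. fps_const (b j k l) * (y k * y l))"
    and "i \<in> J"
  shows "\<exists>q m. (\<exists>j\<le>m. q j \<noteq> 0) \<and> (\<Sum>j\<le>m. fps_of_poly (q j) * y i ^ j) = 0"
proof -
  \<comment> \<open>The inner polynomial variable is t. The cubic term carries the factor X as well,
    so that \<open>F\<close> remains contracting.\<close>
  define F :: "('j \<Rightarrow> 'a poly fps) \<Rightarrow> 'j \<Rightarrow> 'a poly fps" where
    "F f j = fps_const [:c j:] + fps_X * (fps_const [:0, 1:] * f j ^ 3 +
       (\<Sum>k\<in>J. \<Sum>l\<in>J. fps_const [:b j k l:] * (f k * f l)))" for f j
  have "\<exists>f. \<forall>j. f j = F f j"
    unfolding F_def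
    by (rule fps_contraction_fixpoint)
      (intro fps_agree_add fps_agree_X_mult fps_agree_mult fps_agree_sum fps_agree_power fps_agree_refl)
  then obtain f where f: "\<And>j. f j = F f j"
    by blast
  \<comment> \<open>At t = 0 the equations of \<open>f\<close> become those of \<open>y\<close>, and
    the factor X makes their solution unique.\<close>
  have spec: "fps_eval0 (f j) = y j" if "j \<in> J" for j
  proof -
    have "fps_eval0 (f j) = fps_const (c j) + fps_X * (\<Sum>k\<in>J. \<Sum>l\<in>J.
        fps_const (b j k l) * (fps_eval0 (f k) * fps_eval0 (f l)))" for j
      by (subst f, unfold F_def)
        (simp add: fps_eval0_add fps_eval0_mult fps_eval0_sum fps_eval0_const fps_eval0_X)
    note eval = this
    have "\<forall>j\<in>J. fps_agree n (fps_eval0 (f j)) (y j)" for n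
    proof (induction n)
      case (Suc n)
      show ?case
      proof
        fix j assume "j \<in> J"
        show "fps_agree (Suc n) (fps_eval0 (f j)) (y j)"
          unfolding eval[of j] system[OF \<open>j \<in> J\<close>]
          using Suc by (intro fps_agree_add fps_agree_X_mult fps_agree_mult fps_agree_sum fps_agree_refl) auto
      qed
    qed (simp add: fps_agree_def)
    then show ?thesis
      using that by (intro fps_eqI_agree) blast
  qed
  \<comment> \<open>This is t X, the outer variable being X: moving the cubic term to the left makes
    it the common leading coefficient.\<close>
  define s :: "'a poly poly" where "s = [:0, [:0, 1:]:]"
  have "fps_of_poly s * f j ^ 3 = f j - fps_of_poly [:[:c j:]:] -
      (\<Sum>k\<in>J. \<Sum>l\<in>J. fps_of_poly [:0, [:b j k l:]:] * (f k * f l))" for j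
  proof -
    define S T where "S = (\<Sum>k\<in>J. \<Sum>l\<in>J. fps_const [:b j k l:] * (f k * f l))"
      and "T = fps_const [:0, 1:] * f j ^ 3"
    have coeff: "fps_of_poly [:0, d:] = fps_X * fps_const d" for d :: "'a poly"
      by (simp add: fps_of_poly_pCons)
    have "(\<Sum>k\<in>J. \<Sum>l\<in>J. fps_of_poly [:0, [:b j k l:]:] * (f k * f l)) = fps_X * S"
      by (simp add: S_def coeff sum_distrib_left mult.assoc)
    moreover have "fps_of_poly s * f j ^ 3 = fps_X * T"
      by (simp only: s_def T_def coeff mult.assoc)
    moreover have "f j = fps_const [:c j:] + fps_X * (T + S)"
      using f[of j] unfolding F_def S_def T_def .
    then have "f j - fps_const [:c j:] - fps_X * S = fps_X * T"
      by (simp add: algebra_simps)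
    ultimately show ?thesis
      by (simp only: fps_of_poly_const)
  qed
  then obtain q m where "\<exists>j\<le>m. q j \<noteq> 0" "(\<Sum>j\<le>m. fps_of_poly (q j) * f i ^ j) = 0"
    using cubic_system_algebraic[of J s f "\<lambda>j. [:[:c j:]:]" "\<lambda>j k l. [:0, [:b j k l:]:]" i] assms(1,3)
    by (auto simp: s_def)
  then show ?thesis
    using algebraic_eval0[of m q "f i"] spec[OF \<open>i \<in> J\<close>] by auto
qed

section \<open>Weighted walks on stacks\<close>

text \<open>The series in \<open>Y\<close> serve as their own indices, so coinciding generating
  functions are identified.\<close>

definition quadratic_in :: "'a::idom fps set \<Rightarrow> 'a fps \<Rightarrow> bool" where
  "quadratic_in Y q \<longleftrightarrow> (\<exists>b. q = (\<Sum>k\<in>Y. \<Sum>l\<in>Y. fps_const (b k l) * (k * l)))"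

lemma quadratic_in_0: "quadratic_in Y 0"
  unfolding quadratic_in_def by (intro exI[of _ "\<lambda>_ _. 0"]) simp

lemma quadratic_in_add:
  assumes "quadratic_in Y p" "quadratic_in Y q"
  shows "quadratic_in Y (p + q)"
proof -
  obtain b b' where "p = (\<Sum>k\<in>Y. \<Sum>l\<in>Y. fps_const (b k l) * (k * l))"
      "q = (\<Sum>k\<in>Y. \<Sum>l\<in>Y. fps_const (b' k l) * (k * l))"
    using assms unfolding quadratic_in_def by blast
  then show ?thesis
    unfolding quadratic_in_def
    by (intro exI[of _ "\<lambda>k l. b k l + b' k l"])
      (simp add: sum.distrib[symmetric] distrib_right fps_const_add[symmetric] del: fps_const_add)
qed

lemma quadratic_in_scale:
  assumes "quadratic_in Y q"
  shows "quadratic_in Y (fps_const c * q)"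
proof -
  obtain b where "q = (\<Sum>k\<in>Y. \<Sum>l\<in>Y. fps_const (b k l) * (k * l))"
    using assms unfolding quadratic_in_def by blast
  then show ?thesis
    unfolding quadratic_in_def
    by (intro exI[of _ "\<lambda>k l. c * b k l"])
      (simp add: sum_distrib_left mult.assoc fps_const_mult[symmetric] del: fps_const_mult)
qed

lemma quadratic_in_sum:
  assumes "\<And>i. i \<in> I \<Longrightarrow> quadratic_in Y (q i)"
  shows "quadratic_in Y (\<Sum>i\<in>I. q i)"
  using assms
  by (induction I rule: infinite_finite_induct) (auto intro: quadratic_in_add quadratic_in_0)

lemma quadratic_in_mult:
  assumes "finite Y" "f \<in> Y" "g \<in> Y"
  shows "quadratic_in Y (f * g)"
proof -
  have "f * g = (\<Sum>k\<in>Y. if k = f then k * g else 0)"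
    using assms by (simp add: sum.delta)
  also have "\<dots> = (\<Sum>k\<in>Y. if k = f then (\<Sum>l\<in>Y. if l = g then k * l else 0) else 0)"
    using assms by (intro sum.cong) (auto simp: sum.delta)
  also have "\<dots> = (\<Sum>k\<in>Y. \<Sum>l\<in>Y. fps_const (if k = f \<and> l = g then 1 else 0) * (k * l))"
    by (auto intro!: sum.cong)
  finally show ?thesis
    unfolding quadratic_in_def by (intro exI[of _ "\<lambda>k l. if k = f \<and> l = g then 1 else 0"])
qed

lemma quadratic_set_algebraic:
  fixes Y :: "'a::idom fps set"
  assumes "finite Y"
    and "\<And>y. y \<in> Y \<Longrightarrow> \<exists>c q. quadratic_in Y q \<and> y = fps_const c + fps_X * q"
    and "f \<in> Y"
  shows "\<exists>q m. (\<exists>j\<le>m. q j \<noteq> 0) \<and> (\<Sum>j\<le>m. fps_of_poly (q j) * f ^ j) = 0"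
proof -
  let ?rhs = "\<lambda>c b. fps_const c + fps_X * (\<Sum>k\<in>Y. \<Sum>l\<in>Y. fps_const (b k l) * (k * l))"
  have "\<forall>y\<in>Y. \<exists>p. y = ?rhs (fst p) (snd p)"
  proof
    fix y assume "y \<in> Y"
    then obtain c q where "quadratic_in Y q" and y: "y = fps_const c + fps_X * q"
      using assms(2) by blast
    then obtain b where "q = (\<Sum>k\<in>Y. \<Sum>l\<in>Y. fps_const (b k l) * (k * l))"
      unfolding quadratic_in_def by blast
    with y have "y = ?rhs (fst (c, b)) (snd (c, b))"
      by simp
    then show "\<exists>p. y = ?rhs (fst p) (snd p)" ..
  qed
  then obtain p where p: "\<forall>y\<in>Y. y = ?rhs (fst (p y)) (snd (p y))"
    by (rule bchoice[THEN exE])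
  show ?thesis
    by (rule quadratic_system_algebraic[OF \<open>finite Y\<close> _ \<open>f \<in> Y\<close>]) (rule bspec[OF p])
qed

text \<open>The factor X makes coefficient \<open>n + 1\<close> depend only on coefficients
  \<open>n\<close>, so all vanish by induction. Identities between walk generating functions are
  proved below by applying this to the difference of their two sides.\<close>

lemma linear_recursion_zero:
  fixes D :: "'s \<Rightarrow> 'a::idom fps"
  assumes rec: "\<And>v. v \<in> A \<Longrightarrow>
      D v = 0 \<or> (\<exists>S c. S \<subseteq> A \<and> D v = fps_X * (\<Sum>w\<in>S. fps_const (c w) * D w))"
    and "v \<in> A"
  shows "D v = 0"
proof -
  have "\<forall>v\<in>A. fps_nth (D v) n = 0" for n
  proof (induction n)
    case 0
    show ?case
      using rec by fastforce
  next
    case (Suc n)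
    show ?case
    proof
      fix v assume "v \<in> A"
      from rec[OF this] show "fps_nth (D v) (Suc n) = 0"
      proof
        assume "\<exists>S c. S \<subseteq> A \<and> D v = fps_X * (\<Sum>w\<in>S. fps_const (c w) * D w)"
        then obtain S c where "S \<subseteq> A" "D v = fps_X * (\<Sum>w\<in>S. fps_const (c w) * D w)"
          by blast
        then show ?thesis
          using Suc by (auto simp: fps_sum_nth intro!: sum.neutral)
      qed simp
    qed
  qed
  then show ?thesis
    using \<open>v \<in> A\<close> by (simp add: fps_eq_iff)
qed

text \<open>
  States are pairs of a control state and a stack. The assumptions say that the transition
  \<open>w \<rightarrow> w'\<close> of weight \<open>K w' w\<close> only reads and rewrites the top \<open>N\<close> stack symbols.
\<close>
locale pushdown =
  fixes W :: "('q \<times> 'c list) set"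
    and K :: "'q \<times> 'c list \<Rightarrow> 'q \<times> 'c list \<Rightarrow> 'a::idom"
    and N :: nat
  assumes finite_bounded: "finite {w \<in> W. length (snd w) \<le> m}"
    and prefix_closed: "(q, l @ s) \<in> W \<Longrightarrow> (q, l) \<in> W"
    and K_supp: "K w' w \<noteq> 0 \<Longrightarrow> w' \<in> W"
    and K_length: "K w' w \<noteq> 0 \<Longrightarrow> length (snd w') \<le> length (snd w) + N"
    and K_split: "N \<le> length l \<Longrightarrow> K (p, l') (q, l @ s) \<noteq> 0 \<Longrightarrow> \<exists>l''. l' = l'' @ s"
    and K_append: "N \<le> length l \<Longrightarrow> (q, l @ s) \<in> W \<Longrightarrow> K (p, l' @ s) (q, l @ s) = K (p, l') (q, l)"
begin

abbreviation push :: "'c list \<Rightarrow> 'q \<times> 'c list \<Rightarrow> 'q \<times> 'c list" where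
  "push s w \<equiv> (fst w, snd w @ s)"

definition nexts :: "'q \<times> 'c list \<Rightarrow> ('q \<times> 'c list) set" where
  "nexts w = {w'. K w' w \<noteq> 0}"

definition short :: "('q \<times> 'c list) set" where
  "short = {w \<in> W. length (snd w) < N}"

lemma finite_nexts: "finite (nexts w)"
  by (rule finite_subset[OF _ finite_bounded[of "length (snd w) + N"]])
    (auto simp: nexts_def dest: K_supp K_length)

lemma finite_short: "finite short"
  by (rule finite_subset[OF _ finite_bounded[of N]]) (auto simp: short_def)

text \<open>Appending \<open>s\<close> to a state may lead out of \<open>W\<close>. But a step from
  height at least \<open>N\<close> keeps its weight when \<open>s\<close> is placed below, and a
  nonzero weight forces the target into \<open>W\<close>.\<close>

lemma nexts_push_in_W:
  assumes "N \<le> length (snd w)" "push s w \<in> W" "w' \<in> nexts w"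
  shows "push s w' \<in> W"
  using K_append[of "snd w" "fst w" s "fst w'" "snd w'"] assms
    K_supp[of "push s w'" "push s w"]
  by (simp add: nexts_def)

lemma sum_nexts_push:
  assumes "N \<le> length (snd w)" "push s w \<in> W"
  shows "(\<Sum>v\<in>nexts (push s w). fps_const (K v (push s w)) * g v) =
    (\<Sum>v\<in>nexts w. fps_const (K v w) * g (push s v))"
proof -
  have K: "K (push s v) (push s w) = K v w" for v
    using K_append[OF assms(1), of "fst w" s "fst v" "snd v"] assms(2) by simp
  have "nexts (push s w) = push s ` nexts w"
  proof (intro equalityI subsetI)
    fix v assume v: "v \<in> nexts (push s w)"
    then obtain l where "snd v = l @ s"
      using K_split[OF assms(1), of "fst v" "snd v" "fst w" s] by (auto simp: nexts_def)
    then have "v = push s (fst v, l)"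
      by (simp add: prod_eq_iff)
    moreover from this have "(fst v, l) \<in> nexts w"
      using v K[of "(fst v, l)"] by (simp add: nexts_def)
    ultimately show "v \<in> push s ` nexts w"
      by (rule image_eqI)
  next
    fix v assume "v \<in> push s ` nexts w"
    then show "v \<in> nexts (push s w)"
      by (elim imageE) (simp add: nexts_def K)
  qed
  moreover have "inj_on (push s) (nexts w)"
    by (auto simp: inj_on_def prod_eq_iff)
  ultimately show ?thesis
    by (simp add: sum.reindex K)
qed

primrec hit :: "nat \<Rightarrow> 'q \<times> 'c list \<Rightarrow> 'q \<times> 'c list \<Rightarrow> 'a" where
  "hit 0 u v = (if length (snd v) < N \<and> u = v then 1 else 0)"
| "hit (Suc n) u v = (if length (snd v) < N then 0 else \<Sum>w\<in>nexts v. K w v * hit n u w)"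

text \<open>The generating function of the walks from \<open>v\<close> to \<open>u\<close> that stop at the first short stack.\<close>
definition hit_gf :: "'q \<times> 'c list \<Rightarrow> 'q \<times> 'c list \<Rightarrow> 'a fps" where
  "hit_gf u v = Abs_fps (\<lambda>n. hit n u v)"

lemma hit_gf_short: "length (snd v) < N \<Longrightarrow> hit_gf u v = (if u = v then 1 else 0)"
  unfolding fps_eq_iff
proof
  fix n assume "length (snd v) < N"
  then show "fps_nth (hit_gf u v) n = fps_nth (if u = v then 1 else 0) n"
    by (cases n) (auto simp: hit_gf_def)
qed

lemma hit_gf_step:
  "N \<le> length (snd v) \<Longrightarrow> hit_gf u v = fps_X * (\<Sum>w\<in>nexts v. fps_const (K w v) * hit_gf u w)"
  unfolding fps_eq_iff
proof
  fix n assume "N \<le> length (snd v)"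
  then show "fps_nth (hit_gf u v) n =
      fps_nth (fps_X * (\<Sum>w\<in>nexts v. fps_const (K w v) * hit_gf u w)) n"
    by (cases n) (auto simp: hit_gf_def fps_sum_nth)
qed

text \<open>Steps from height at least \<open>N\<close> preserve the property that \<open>s\<close>
  fits below the stack, so a walk starting with it cannot stop at a \<open>u\<close> without it.
  This disposes of the summands of \<open>hit_gf_push\<close> in which \<open>push s u'\<close> is
  not a state.\<close>

lemma hit_gf_push_eq_0:
  assumes "push s u \<notin> W" "push s w \<in> W"
  shows "hit_gf u w = 0"
proof (rule linear_recursion_zero[where A = "{w. push s w \<in> W}"])
  fix v assume v: "v \<in> {w. push s w \<in> W}"
  show "hit_gf u v = 0 \<or> (\<exists>S c. S \<subseteq> {w. push s w \<in> W} \<and>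
      hit_gf u v = fps_X * (\<Sum>w\<in>S. fps_const (c w) * hit_gf u w))"
  proof (cases "length (snd v) < N")
    case True
    then show ?thesis
      using v assms(1) hit_gf_short[of v u] by auto
  next
    case False
    then have "nexts v \<subseteq> {w. push s w \<in> W}"
      using v nexts_push_in_W[of v s] by auto
    then show ?thesis
      using hit_gf_step[of v u] False by (intro disjI2 exI[of _ "nexts v"] exI[of _ "\<lambda>w. K w v"]) auto
  qed
qed (use assms in simp)

text \<open>First-passage decomposition: until the part above \<open>s\<close> first becomes short,
  at some \<open>u'\<close>, the walk never touches \<open>s\<close>; what remains is a walk from
  \<open>push s u'\<close>. Formally, both sides obey the same recursion in
  \<open>w\<close>.\<close>

lemma hit_gf_push:
  assumes "push s w \<in> W"
  shows "hit_gf u (push s w) = (\<Sum>u'\<in>short. hit_gf u' w * hit_gf u (push s u'))"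
proof -
  define D where "D w = hit_gf u (push s w) - (\<Sum>u'\<in>short. hit_gf u' w * hit_gf u (push s u'))" for w
  have "D w = 0"
  proof (rule linear_recursion_zero[where A = "{w. push s w \<in> W}"])
    fix v assume v: "v \<in> {w. push s w \<in> W}"
    show "D v = 0 \<or> (\<exists>S c. S \<subseteq> {w. push s w \<in> W} \<and> D v = fps_X * (\<Sum>w\<in>S. fps_const (c w) * D w))"
    proof (cases "length (snd v) < N")
      case True
      then have "v \<in> short"
        using v prefix_closed[of "fst v" "snd v" s] by (simp add: short_def)
      moreover have "(\<Sum>u'\<in>short. hit_gf u' v * hit_gf u (push s u')) =
          (\<Sum>u'\<in>short. if u' = v then hit_gf u (push s u') else 0)"
        using True by (intro sum.cong) (auto simp: hit_gf_short)
      ultimately have "D v = 0"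
        by (simp add: D_def finite_short)
      then show ?thesis ..
    next
      case False
      then have long: "N \<le> length (snd v)"
        by simp
      have "hit_gf u (push s v) = fps_X * (\<Sum>w\<in>nexts v. fps_const (K w v) * hit_gf u (push s w))"
        using hit_gf_step[of "push s v" u] sum_nexts_push[OF long, of s "hit_gf u"] v long by simp
      moreover have "(\<Sum>u'\<in>short. hit_gf u' v * hit_gf u (push s u')) = fps_X *
          (\<Sum>w\<in>nexts v. fps_const (K w v) * (\<Sum>u'\<in>short. hit_gf u' w * hit_gf u (push s u')))"
        unfolding hit_gf_step[OF long] sum_distrib_left sum_distrib_right
        by (subst sum.swap) (simp add: mult.assoc)
      ultimately have "D v = fps_X * (\<Sum>w\<in>nexts v. fps_const (K w v) * D w)"
        by (simp add: D_def right_diff_distrib sum_subtractf)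
      moreover have "nexts v \<subseteq> {w. push s w \<in> W}"
        using v nexts_push_in_W[OF long] by auto
      ultimately show ?thesis
        by (intro disjI2 exI[of _ "nexts v"] exI[of _ "\<lambda>w. K w v"]) auto
    qed
  qed (use assms in simp)
  then show ?thesis
    by (simp add: D_def)
qed

text \<open>The recursion makes \<open>G\<close> the generating function of all walks to the short
  state \<open>a\<close>. Such a walk meets a short stack, at the latest at its end, and is cut at
  the first one.\<close>

lemma walk_gf_eq:
  assumes rec: "\<And>v. v \<in> W \<Longrightarrow>
      G v = fps_const (if v = a then 1 else 0) + fps_X * (\<Sum>w\<in>nexts v. fps_const (K w v) * G w)"
    and "a \<in> short" "v \<in> W"
  shows "G v = (\<Sum>u\<in>short. G u * hit_gf u v)"
proof -
  define D where "D v = G v - (\<Sum>u\<in>short. G u * hit_gf u v)" for v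
  have "D v = 0"
  proof (rule linear_recursion_zero[where A = W])
    fix v assume v: "v \<in> W"
    show "D v = 0 \<or> (\<exists>S c. S \<subseteq> W \<and> D v = fps_X * (\<Sum>w\<in>S. fps_const (c w) * D w))"
    proof (cases "length (snd v) < N")
      case True
      then have "(\<Sum>u\<in>short. G u * hit_gf u v) = (\<Sum>u\<in>short. if u = v then G u else 0)"
        by (intro sum.cong) (auto simp: hit_gf_short)
      moreover have "v \<in> short"
        using True v by (simp add: short_def)
      ultimately have "D v = 0"
        by (simp add: D_def finite_short)
      then show ?thesis ..
    next
      case False
      then have long: "N \<le> length (snd v)"
        by simp
      have "v \<noteq> a"
        using assms(2) long by (auto simp: short_def)
      then have "G v = fps_X * (\<Sum>w\<in>nexts v. fps_const (K w v) * G w)"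
        using rec[OF v] by simp
      moreover have "(\<Sum>u\<in>short. G u * hit_gf u v) = fps_X *
          (\<Sum>w\<in>nexts v. fps_const (K w v) * (\<Sum>u\<in>short. G u * hit_gf u w))"
        unfolding hit_gf_step[OF long] sum_distrib_left
        by (subst sum.swap) (simp add: mult_ac)
      ultimately have "D v = fps_X * (\<Sum>w\<in>nexts v. fps_const (K w v) * D w)"
        by (simp add: D_def right_diff_distrib sum_subtractf)
      moreover have "nexts v \<subseteq> W"
        by (auto simp: nexts_def dest: K_supp)
      ultimately show ?thesis
        by (intro disjI2 exI[of _ "nexts v"] exI[of _ "\<lambda>w. K w v"]) auto
    qed
  qed (use assms in simp)
  then show ?thesis
    by (simp add: D_def)
qed

theorem walk_gf_algebraic:
  fixes \<mu> :: "'q \<times> 'c list \<Rightarrow> 'a"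
  assumes "finite T" "T \<subseteq> short"
    and rec: "\<And>a v. a \<in> T \<Longrightarrow> v \<in> W \<Longrightarrow> G a v =
      fps_const (if v = a then 1 else 0) + fps_X * (\<Sum>w\<in>nexts v. fps_const (K w v) * G a w)"
  defines "f \<equiv> fps_X * (\<Sum>a\<in>T. fps_const (\<mu> a) * G a a)"
  shows "\<exists>q m. (\<exists>j\<le>m. q j \<noteq> 0) \<and> (\<Sum>j\<le>m. fps_of_poly (q j) * f ^ j) = 0"
proof -
  \<comment> \<open>One step from height at most \<open>N\<close> ends within this bound, and so
    does placing a short stack on at most \<open>N\<close> symbols.\<close>
  define R where "R = {w \<in> W. length (snd w) \<le> 2 * N}"
  define Y where "Y = {1, f} \<union> case_prod hit_gf ` (short \<times> R) \<union> case_prod G ` (T \<times> short)"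
  have finY: "finite Y"
    unfolding Y_def R_def using finite_short finite_bounded[of "2 * N"] \<open>finite T\<close> by auto
  have one: "1 \<in> Y"
    by (simp add: Y_def)
  have hitY: "hit_gf u v \<in> Y" if "u \<in> short" "v \<in> R" for u v
    using that by (force simp: Y_def)
  have GY: "G a v \<in> Y" if "a \<in> T" "v \<in> short" for a v
    using that by (force simp: Y_def)
  have "short \<subseteq> R"
    by (auto simp: short_def R_def)
  have nextsR: "w \<in> R" if "w \<in> nexts v" "length (snd v) \<le> N" for v w
    using that K_supp[of w v] K_length[of w v] by (auto simp: R_def nexts_def)
  show ?thesis
  proof (rule quadratic_set_algebraic[OF finY])
    show "f \<in> Y"
      by (simp add: Y_def)
    fix y assume "y \<in> Y"
    then consider "y = 1" | "y = f" | u v where "u \<in> short" "v \<in> R" "y = hit_gf u v"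
      | a v where "a \<in> T" "v \<in> short" "y = G a v"
      unfolding Y_def by auto
    then show "\<exists>c q. quadratic_in Y q \<and> y = fps_const c + fps_X * q"
    proof cases
      case 1
      then show ?thesis
        by (intro exI[of _ 1] exI[of _ 0]) (simp add: quadratic_in_0)
    next
      case 2
      have "quadratic_in Y (\<Sum>a\<in>T. fps_const (\<mu> a) * (1 * G a a))"
        using assms(2) by (intro quadratic_in_sum quadratic_in_scale quadratic_in_mult finY one GY) auto
      then show ?thesis
        unfolding 2 f_def by (intro exI[of _ 0] exI conjI, assumption) simp
    next
      case (3 u v)
      show ?thesis
      proof (cases "length (snd v) < N")
        case True
        then show ?thesis
          unfolding 3 hit_gf_short[OF True]
          by (intro exI[of _ "if u = v then 1 else 0"] exI[of _ 0]) (simp add: quadratic_in_0)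
      next
        case False
        define w s where "w = (fst v, take N (snd v))" and "s = drop N (snd v)"
        have v: "v = push s w"
          by (simp add: w_def s_def)
        have w: "length (snd w) = N" and s: "length s \<le> N" and "push s w \<in> W"
          using False 3 by (auto simp: w_def s_def R_def)
        have "hit_gf u v = fps_X * (\<Sum>w'\<in>nexts w. fps_const (K w' w) * hit_gf u (push s w'))"
          unfolding v using hit_gf_step[of "push s w" u] sum_nexts_push[of w s "hit_gf u"] w \<open>push s w \<in> W\<close>
          by simp
        also have "\<dots> = fps_X * (\<Sum>w'\<in>nexts w. fps_const (K w' w) *
            (\<Sum>u'\<in>short. hit_gf u' w' * hit_gf u (push s u')))" (is "_ = fps_X * ?q")
          using nexts_push_in_W[of w s] w \<open>push s w \<in> W\<close>
          by (intro arg_cong[where f = "(*) fps_X"] sum.cong) (auto simp: hit_gf_push)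
        finally have y: "y = fps_const 0 + fps_X * ?q"
          using 3 by simp
        have "quadratic_in Y (hit_gf u' w' * hit_gf u (push s u'))"
          if "w' \<in> nexts w" "u' \<in> short" for w' u'
        proof (cases "push s u' \<in> W")
          case True
          then have "push s u' \<in> R"
            using that s by (auto simp: R_def short_def)
          then show ?thesis
            using that w 3 by (intro quadratic_in_mult finY hitY nextsR[of w' w]) auto
        next
          case False
          then have "hit_gf u' w' = 0"
            using hit_gf_push_eq_0 nexts_push_in_W[of w s w'] that w \<open>push s w \<in> W\<close> by auto
          then show ?thesis
            by (simp add: quadratic_in_0)
        qed
        then have "quadratic_in Y ?q"
          by (intro quadratic_in_sum quadratic_in_scale) auto
        then show ?thesis
          using y by blast
      qed
    next
      case (4 a v)
      have v: "v \<in> W" "length (snd v) \<le> N"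
        using 4 by (auto simp: short_def)
      \<comment> \<open>A step from a short stack may end at a taller one, for which
        \<open>Y\<close> was not given a \<open>G\<close>; this replaces it by products of members
        of \<open>Y\<close>.\<close>
      have G: "G a w = (\<Sum>u\<in>short. G a u * hit_gf u w)" if "w \<in> W" for w
        by (rule walk_gf_eq[where a = a]) (use 4 assms(2) rec that in auto)
      have "G a v = fps_const (if v = a then 1 else 0) + fps_X * (\<Sum>w\<in>nexts v. fps_const (K w v) * G a w)"
        using rec 4 v by blast
      also have "(\<Sum>w\<in>nexts v. fps_const (K w v) * G a w) =
          (\<Sum>w\<in>nexts v. fps_const (K w v) * (\<Sum>u\<in>short. G a u * hit_gf u w))" (is "_ = ?q")
        using G K_supp[of _ v] by (intro sum.cong) (auto simp: nexts_def)
      finally have "y = fps_const (if v = a then 1 else 0) + fps_X * ?q"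
        using 4 by simp
      moreover have "quadratic_in Y ?q"
        using 4 v by (intro quadratic_in_sum quadratic_in_scale quadratic_in_mult finY hitY GY nextsR[of _ v]) auto
      ultimately show ?thesis
        by blast
    qed
  qed
qed

end

section \<open>Local operators on the Fock space\<close>

lemma walk_from_start: "graph_wf V Ed ends \<Longrightarrow> walk_from V Ed ends v l \<Longrightarrow> v \<in> V"
  by (cases l) (auto simp: dedges_def graph_wf_def dsrc_def, blast)

lemma walk_from_prefix:
  "graph_wf V Ed ends \<Longrightarrow> walk_from V Ed ends v (l @ s) \<Longrightarrow> walk_from V Ed ends v l"
  by (induction l arbitrary: v) (auto dest: walk_from_start)

lemma valid_path_prefix:
  "graph_wf V Ed ends \<Longrightarrow> valid_path V Ed ends (v, l @ s) \<Longrightarrow> valid_path V Ed ends (v, l)"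
  using walk_from_prefix by (auto simp: valid_path_def)

lemma walk_from_edges: "walk_from V Ed ends v l \<Longrightarrow> set l \<subseteq> dedges Ed ends"
  by (induction l arbitrary: v) auto

lemma finite_valid_path_bounded:
  assumes "graph_wf V Ed ends"
  shows "finite {w. valid_path V Ed ends w \<and> length (snd w) \<le> m}"
proof (rule finite_subset)
  show "{w. valid_path V Ed ends w \<and> length (snd w) \<le> m} \<subseteq>
      V \<times> {l. set l \<subseteq> dedges Ed ends \<and> length l \<le> m}"
    using assms by (auto simp: valid_path_def dest: walk_from_start subsetD[OF walk_from_edges])
  have "dedges Ed ends = Sigma Ed ends"
    by (auto simp: dedges_def)
  then have "finite (dedges Ed ends)"
    using assms by (auto simp: graph_wf_def intro!: finite_SigmaI intro: finite_subset)
  then show "finite (V \<times> {l. set l \<subseteq> dedges Ed ends \<and> length l \<le> m})"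
    using assms finite_lists_length_le by (auto simp: graph_wf_def)
qed

lemma dtgt_in_ends:
  assumes "graph_wf V Ed ends" "\<epsilon> \<in> dedges Ed ends"
  shows "dtgt ends \<epsilon> \<in> ends (fst \<epsilon>)"
proof -
  obtain e a where \<epsilon>: "\<epsilon> = (e, a)" "e \<in> Ed" "a \<in> ends e"
    using assms(2) by (auto simp: dedges_def)
  show ?thesis
  proof (cases "ends e = {a}")
    case True
    then show ?thesis
      using \<epsilon> by (simp add: dtgt_def)
  next
    case False
    then have "card (ends e) = 2"
      using assms(1) \<epsilon> by (metis card_1_singletonE graph_wf_def singletonD)
    then obtain c d where "ends e = {c, d}" "c \<noteq> d"
      by (auto simp: card_2_iff)
    then obtain b where "ends e = {a, b}" "a \<noteq> b"
      using \<epsilon>(3) by (cases "a = c") (auto simp: insert_commute)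
    then have "(THE c. c \<in> ends e \<and> c \<noteq> a) = b"
      by (intro the_equality) auto
    then show ?thesis
      using \<open>ends e = {a, b}\<close> False by (simp add: dtgt_def \<epsilon>(1))
  qed
qed

lemma dopp_in_dedges:
  "graph_wf V Ed ends \<Longrightarrow> \<epsilon> \<in> dedges Ed ends \<Longrightarrow> dopp ends \<epsilon> \<in> dedges Ed ends"
  using dtgt_in_ends[of V Ed ends \<epsilon>] by (auto simp: dopp_def dedges_def)

text \<open>
  Operators on the Fock space that only rewrite the first \<open>N\<close> letters of a path, such as
  polynomials in creation and annihilation operators.
\<close>
definition local_kernel ::
    "'v set \<Rightarrow> 'e set \<Rightarrow> ('e \<Rightarrow> 'v set) \<Rightarrow> nat \<Rightarrow> ('v, 'e) kern \<Rightarrow> bool" where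
  "local_kernel V Ed ends N K \<longleftrightarrow>
     (\<forall>w' w. K w' w \<noteq> 0 \<longrightarrow> valid_path V Ed ends w' \<and> valid_path V Ed ends w \<and>
        length (snd w') \<le> length (snd w) + N \<and> length (snd w) \<le> length (snd w') + N) \<and>
     (\<forall>a l' b l s. N \<le> length l \<longrightarrow> K (a, l') (b, l @ s) \<noteq> 0 \<longrightarrow> (\<exists>l''. l' = l'' @ s)) \<and>
     (\<forall>a l' b l s. N \<le> length l \<longrightarrow> valid_path V Ed ends (b, l @ s) \<longrightarrow>
        K (a, l' @ s) (b, l @ s) = K (a, l') (b, l))"

lemma local_kernelD:
  assumes "local_kernel V Ed ends N K"
  shows "K w' w \<noteq> 0 \<Longrightarrow> valid_path V Ed ends w'"
    and "K w' w \<noteq> 0 \<Longrightarrow> valid_path V Ed ends w"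
    and "K w' w \<noteq> 0 \<Longrightarrow> length (snd w') \<le> length (snd w) + N"
    and "K w' w \<noteq> 0 \<Longrightarrow> length (snd w) \<le> length (snd w') + N"
    and "N \<le> length l \<Longrightarrow> K (a, l') (b, l @ s) \<noteq> 0 \<Longrightarrow> \<exists>l''. l' = l'' @ s"
    and "N \<le> length l \<Longrightarrow> valid_path V Ed ends (b, l @ s) \<Longrightarrow> K (a, l' @ s) (b, l @ s) = K (a, l') (b, l)"
proof -
  note D = assms[unfolded local_kernel_def]
  note D1 = conjunct1[OF D, rule_format] and D2 = conjunct1[OF conjunct2[OF D], rule_format]
    and D3 = conjunct2[OF conjunct2[OF D], rule_format]
  show "valid_path V Ed ends w'" "valid_path V Ed ends w"
      "length (snd w') \<le> length (snd w) + N" "length (snd w) \<le> length (snd w') + N" if "K w' w \<noteq> 0"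
    using D1[OF that] by simp_all
  show "\<exists>l''. l' = l'' @ s" if "N \<le> length l" "K (a, l') (b, l @ s) \<noteq> 0"
    by (rule D2[OF that])
  show "K (a, l' @ s) (b, l @ s) = K (a, l') (b, l)" if "N \<le> length l" "valid_path V Ed ends (b, l @ s)"
    by (rule D3[OF that])
qed

lemma local_kernelI:
  assumes "\<And>w' w. K w' w \<noteq> 0 \<Longrightarrow> valid_path V Ed ends w' \<and> valid_path V Ed ends w \<and>
      length (snd w') \<le> length (snd w) + N \<and> length (snd w) \<le> length (snd w') + N"
    and "\<And>a l' b l s. N \<le> length l \<Longrightarrow> K (a, l') (b, l @ s) \<noteq> 0 \<Longrightarrow> \<exists>l''. l' = l'' @ s"
    and "\<And>a l' b l s. N \<le> length l \<Longrightarrow> valid_path V Ed ends (b, l @ s) \<Longrightarrow>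
      K (a, l' @ s) (b, l @ s) = K (a, l') (b, l)"
  shows "local_kernel V Ed ends N K"
  unfolding local_kernel_def by (intro conjI allI impI assms)

lemma local_kernel_mono:
  assumes K: "local_kernel V Ed ends N K" and "N \<le> N'"
  shows "local_kernel V Ed ends N' K"
proof (rule local_kernelI)
  fix w' w assume "K w' w \<noteq> 0"
  from local_kernelD(1-4)[OF K this] assms(2)
  show "valid_path V Ed ends w' \<and> valid_path V Ed ends w \<and>
      length (snd w') \<le> length (snd w) + N' \<and> length (snd w) \<le> length (snd w') + N'"
    by simp
next
  fix a l' b and l s :: "('b \<times> 'a) list"
  assume "N' \<le> length l"
  then have l: "N \<le> length l"
    using assms(2) by simp
  show "\<exists>l''. l' = l'' @ s" if "K (a, l') (b, l @ s) \<noteq> 0"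
    by (rule local_kernelD(5)[OF K l that])
  show "K (a, l' @ s) (b, l @ s) = K (a, l') (b, l)" if "valid_path V Ed ends (b, l @ s)"
    by (rule local_kernelD(6)[OF K l that])
qed

lemma local_kernel_kadd:
  assumes "local_kernel V Ed ends N K" "local_kernel V Ed ends N L"
  shows "local_kernel V Ed ends N (kadd K L)"
proof -
  have *: "K w' w \<noteq> 0 \<or> L w' w \<noteq> 0" if "kadd K L w' w \<noteq> 0" for w' w
    using that by (auto simp: kadd_def)
  show ?thesis
    unfolding local_kernel_def
  proof (intro conjI allI impI)
    fix a l' b l s
    assume "N \<le> length l" "kadd K L (a, l') (b, l @ s) \<noteq> 0"
    then show "\<exists>l''. l' = l'' @ s"
      using * local_kernelD(5)[OF assms(1)] local_kernelD(5)[OF assms(2)] by blast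
  next
    fix a l' b l s
    assume "N \<le> length l" "valid_path V Ed ends (b, l @ s)"
    then show "kadd K L (a, l' @ s) (b, l @ s) = kadd K L (a, l') (b, l)"
      by (simp add: kadd_def local_kernelD(6)[OF assms(1)] local_kernelD(6)[OF assms(2)])
  qed (use * local_kernelD(1-4)[OF assms(1)] local_kernelD(1-4)[OF assms(2)] in blast)+
qed

lemma local_kernel_ksmul:
  assumes "local_kernel V Ed ends N K"
  shows "local_kernel V Ed ends N (ksmul c K)"
proof (rule local_kernelI)
  fix w' w assume "ksmul c K w' w \<noteq> 0"
  then have "K w' w \<noteq> 0"
    by (simp add: ksmul_def)
  from local_kernelD(1-4)[OF assms this]
  show "valid_path V Ed ends w' \<and> valid_path V Ed ends w \<and>
      length (snd w') \<le> length (snd w) + N \<and> length (snd w) \<le> length (snd w') + N"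
    by simp
next
  fix a l' b and l s :: "('b \<times> 'a) list"
  assume l: "N \<le> length l"
  show "\<exists>l''. l' = l'' @ s" if "ksmul c K (a, l') (b, l @ s) \<noteq> 0"
    using local_kernelD(5)[OF assms l, of a l' b s] that by (simp add: ksmul_def)
  show "ksmul c K (a, l' @ s) (b, l @ s) = ksmul c K (a, l') (b, l)" if "valid_path V Ed ends (b, l @ s)"
    using local_kernelD(6)[OF assms l that] by (simp add: ksmul_def)
qed

text \<open>A local operator lengthens paths by a bounded amount, and a finite graph has finitely
  many paths of bounded length. This makes the infinite sum in \<open>kmult\<close> finite.\<close>

lemma finite_local_kernel_support:
  assumes "graph_wf V Ed ends" "local_kernel V Ed ends N K"
  shows "finite {u. K u w \<noteq> 0}"
proof (rule finite_subset)
  show "{u. K u w \<noteq> 0} \<subseteq> {u. valid_path V Ed ends u \<and> length (snd u) \<le> length (snd w) + N}"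
    by (intro Collect_mono impI conjI) (erule local_kernelD[OF assms(2)])+
qed (rule finite_valid_path_bounded[OF assms(1)])

lemma infsum_finite_support:
  assumes "finite S" "\<And>u. u \<notin> S \<Longrightarrow> f u = 0"
  shows "(\<Sum>\<^sub>\<infinity>u. f u) = sum f S"
proof -
  have "infsum f UNIV = infsum f S"
    by (rule infsum_cong_neutral) (use assms in auto)
  then show ?thesis
    using assms by simp
qed

lemma kmult_eq_sum:
  assumes "finite {u. L u w \<noteq> 0}"
  shows "kmult K L w' w = (\<Sum>u | L u w \<noteq> 0. K w' u * L u w)"
  unfolding kmult_def by (rule infsum_finite_support) (use assms in auto)

lemma local_kernel_kmult:
  assumes wf: "graph_wf V Ed ends"
    and K: "local_kernel V Ed ends M K" and L: "local_kernel V Ed ends N L"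
  shows "local_kernel V Ed ends (M + N) (kmult K L)"
proof -
  note eq = kmult_eq_sum[OF finite_local_kernel_support[OF wf L]]
  have *: "\<exists>u. K w' u \<noteq> 0 \<and> L u w \<noteq> 0" if "kmult K L w' w \<noteq> 0" for w' w
  proof (rule ccontr)
    assume "\<not> ?thesis"
    then have "kmult K L w' w = 0"
      unfolding eq by (intro sum.neutral) auto
    then show False
      using that by simp
  qed
  \<comment> \<open>Here the lower bound on the output length enters: \<open>L\<close> removes at
    most \<open>N\<close> of the letters above \<open>s\<close>, which leaves \<open>K\<close>
    enough letters to act without reaching \<open>s\<close>.\<close>
  have long: "M \<le> length r" if "L (c, r @ s) (b, l @ s) \<noteq> 0" "M + N \<le> length l" for c r s b l
    using local_kernelD(4)[OF L that(1)] that(2) by simp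
  show ?thesis
    unfolding local_kernel_def
  proof (intro conjI allI impI)
    fix w' w assume "kmult K L w' w \<noteq> 0"
    then obtain u where "K w' u \<noteq> 0" "L u w \<noteq> 0"
      using * by blast
    note D = local_kernelD(1-4)[OF K this(1)] local_kernelD(1-4)[OF L this(2)]
    show "valid_path V Ed ends w'" "valid_path V Ed ends w"
        "length (snd w') \<le> length (snd w) + (M + N)" "length (snd w) \<le> length (snd w') + (M + N)"
      using D by auto
  next
    fix a l' b l s
    assume l: "M + N \<le> length l" and "kmult K L (a, l') (b, l @ s) \<noteq> 0"
    then obtain c r where u: "K (a, l') (c, r) \<noteq> 0" "L (c, r) (b, l @ s) \<noteq> 0"
      using * by (metis surj_pair)
    have "N \<le> length l"
      using l by simp
    then obtain r' where r': "r = r' @ s"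
      using local_kernelD(5)[OF L _ u(2)] by blast
    then have "M \<le> length r'"
      using long u(2) l by blast
    then show "\<exists>l''. l' = l'' @ s"
      using local_kernelD(5)[OF K] u(1) r' by blast
  next
    fix a l' b l s
    assume l: "M + N \<le> length l" and valid: "valid_path V Ed ends (b, l @ s)"
    define push where "push = (\<lambda>(c, r :: ('b \<times> 'a) list). (c :: 'a, r @ s))"
    have L_push: "L (push u) (b, l @ s) = L u (b, l)" for u
      using local_kernelD(6)[OF L _ valid] l by (cases u) (simp add: push_def)
    have "{u. L u (b, l @ s) \<noteq> 0} = push ` {u. L u (b, l) \<noteq> 0}"
    proof (intro equalityI subsetI)
      fix u assume u: "u \<in> {u. L u (b, l @ s) \<noteq> 0}"
      then obtain r where "snd u = r @ s"
        using local_kernelD(5)[OF L, of l "fst u" "snd u" b s] l by auto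
      then have "u = push (fst u, r)"
        by (simp add: prod_eq_iff push_def)
      then show "u \<in> push ` {u. L u (b, l) \<noteq> 0}"
        using u L_push by (metis (mono_tags, lifting) image_eqI mem_Collect_eq)
    qed (auto simp: L_push)
    moreover have "inj_on push {u. L u (b, l) \<noteq> 0}"
      by (auto simp: inj_on_def push_def)
    ultimately have "kmult K L (a, l' @ s) (b, l @ s) =
        (\<Sum>u | L u (b, l) \<noteq> 0. K (a, l' @ s) (push u) * L u (b, l))"
      unfolding eq by (simp add: sum.reindex L_push)
    also have "\<dots> = (\<Sum>u | L u (b, l) \<noteq> 0. K (a, l') u * L u (b, l))"
    proof (rule sum.cong)
      fix u assume "u \<in> {u. L u (b, l) \<noteq> 0}"
      then have "L (push u) (b, l @ s) \<noteq> 0"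
        by (simp add: L_push)
      then have "K (a, l' @ s) (push u) = K (a, l') u"
        using local_kernelD(1)[OF L] long[of "fst u" "snd u"] l
        by (cases u) (auto simp: push_def intro!: local_kernelD(6)[OF K])
      then show "K (a, l' @ s) (push u) * L u (b, l) = K (a, l') u * L u (b, l)"
        by simp
    qed simp
    finally show "kmult K L (a, l' @ s) (b, l @ s) = kmult K L (a, l') (b, l)"
      unfolding eq .
  qed
qed

section \<open>Adjoints and two-sided locality\<close>

lemma kadj_kadj [simp]: "kadj (kadj K) = K"
  by (simp add: kadj_def)

lemma kadj_kadd: "kadj (kadd K L) = kadd (kadj K) (kadj L)"
  by (simp add: kadj_def kadd_def)

lemma kadj_ksmul: "kadj (ksmul c K) = ksmul (cnj c) (kadj K)"
  by (simp add: kadj_def ksmul_def)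

lemma kadj_kmult: "kadj (kmult K L) = kmult (kadj L) (kadj K)"
  by (simp add: kadj_def kmult_def mult.commute flip: infsum_cnj)

text \<open>Demanding locality of the adjoint too makes the property pass to adjoints at once, as
  the induction over \<open>Aalg\<close> requires. The two radii may differ.\<close>

definition bilocal_kernel :: "'v set \<Rightarrow> 'e set \<Rightarrow> ('e \<Rightarrow> 'v set) \<Rightarrow> ('v, 'e) kern \<Rightarrow> bool" where
  "bilocal_kernel V Ed ends K \<longleftrightarrow>
     (\<exists>N. local_kernel V Ed ends N K) \<and> (\<exists>N. local_kernel V Ed ends N (kadj K))"

lemma bilocal_kernel_kadj: "bilocal_kernel V Ed ends K \<Longrightarrow> bilocal_kernel V Ed ends (kadj K)"
  by (simp add: bilocal_kernel_def)

lemma ex_local_kernel_kadd: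
  assumes "\<exists>N. local_kernel V Ed ends N K" "\<exists>N. local_kernel V Ed ends N L"
  shows "\<exists>N. local_kernel V Ed ends N (kadd K L)"
proof -
  obtain M N where "local_kernel V Ed ends M K" "local_kernel V Ed ends N L"
    using assms by blast
  then show ?thesis
    by (intro exI[of _ "max M N"] local_kernel_kadd) (auto elim: local_kernel_mono)
qed

lemma bilocal_kernel_kadd:
  "bilocal_kernel V Ed ends K \<Longrightarrow> bilocal_kernel V Ed ends L \<Longrightarrow> bilocal_kernel V Ed ends (kadd K L)"
  by (simp add: bilocal_kernel_def kadj_kadd ex_local_kernel_kadd)

lemma bilocal_kernel_ksmul:
  "bilocal_kernel V Ed ends K \<Longrightarrow> bilocal_kernel V Ed ends (ksmul c K)"
  unfolding bilocal_kernel_def kadj_ksmul using local_kernel_ksmul by blast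

lemma bilocal_kernel_kmult:
  "graph_wf V Ed ends \<Longrightarrow> bilocal_kernel V Ed ends K \<Longrightarrow> bilocal_kernel V Ed ends L \<Longrightarrow>
    bilocal_kernel V Ed ends (kmult K L)"
  unfolding bilocal_kernel_def kadj_kmult using local_kernel_kmult by metis

lemma bilocal_kernel_kproj:
  assumes "graph_wf V Ed ends"
  shows "bilocal_kernel V Ed ends (kproj V Ed ends \<beta>)"
proof -
  have "local_kernel V Ed ends 0 (kproj V Ed ends \<beta>)"
    using valid_path_prefix[OF assms] by (auto simp: local_kernel_def kproj_def split: if_splits)
  moreover have "kadj (kproj V Ed ends \<beta>) = kproj V Ed ends \<beta>"
    by (auto simp: kadj_def kproj_def fun_eq_iff)
  ultimately show ?thesis
    unfolding bilocal_kernel_def by auto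
qed

text \<open>Creation looks only at the start vertex. Annihilation has to see the first letter, which
  at radius 1 lies in the nonempty \<open>l\<close> and not in \<open>s\<close>.\<close>

lemma bilocal_kernel_kcreat:
  assumes wf: "graph_wf V Ed ends" and \<epsilon>: "\<epsilon> \<in> dedges Ed ends"
  shows "bilocal_kernel V Ed ends (kcreat V Ed ends \<epsilon>)"
proof -
  have valid: "valid_path V Ed ends (dsrc \<epsilon>, \<epsilon> # l) \<longleftrightarrow> valid_path V Ed ends (dtgt ends \<epsilon>, l)" for l
    using \<epsilon> by (simp add: valid_path_def)
  have "local_kernel V Ed ends 1 (kcreat V Ed ends \<epsilon>)"
    unfolding local_kernel_def
    using valid valid_path_prefix[OF wf] by (auto simp: kcreat_def split: if_splits)
  moreover have "local_kernel V Ed ends 1 (kadj (kcreat V Ed ends \<epsilon>))"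
    unfolding local_kernel_def
  proof (intro conjI allI impI)
    fix a l' b l s
    assume l: "1 \<le> length l" and "valid_path V Ed ends (b, l @ s)"
    then show "kadj (kcreat V Ed ends \<epsilon>) (a, l' @ s) (b, l @ s) =
        kadj (kcreat V Ed ends \<epsilon>) (a, l') (b, l)"
      using valid_path_prefix[OF wf, of a l' s] valid[of "l' @ s"]
      by (cases l) (auto simp: kadj_def kcreat_def)
  next
    fix a l' b l s
    assume "1 \<le> length l" "kadj (kcreat V Ed ends \<epsilon>) (a, l') (b, l @ s) \<noteq> 0"
    then show "\<exists>l''. l' = l'' @ s"
      by (cases l) (auto simp: kadj_def kcreat_def split: if_splits)
  qed (use valid in \<open>auto simp: kadj_def kcreat_def split: if_splits\<close>)
  ultimately show ?thesis
    unfolding bilocal_kernel_def by blast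
qed

lemma bilocal_kernel_Xund:
  assumes wf: "graph_wf V Ed ends" and e: "e \<in> Ed"
  shows "bilocal_kernel V Ed ends (Xund V Ed ends \<mu> e)"
proof -
  have "ends e \<noteq> {}"
    using wf e by (force simp: graph_wf_def)
  then have "(e, SOME a. a \<in> ends e) \<in> dedges Ed ends"
    using e some_in_eq by (auto simp: dedges_def)
  then show ?thesis
    unfolding Xund_def Let_def using wf
    by (auto intro!: bilocal_kernel_kadd bilocal_kernel_ksmul bilocal_kernel_kadj bilocal_kernel_kcreat
        dopp_in_dedges)
qed

lemma bilocal_kernel_Aalg:
  assumes wf: "graph_wf V Ed ends" and "K \<in> Aalg V Ed ends \<mu>"
  shows "bilocal_kernel V Ed ends K"
  using assms(2)
proof induction
  case (gen_X \<epsilon>)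
  then have "fst \<epsilon> \<in> Ed"
    by (auto simp: dedges_def)
  then show ?case
    unfolding Xdir_def by (intro bilocal_kernel_kmult bilocal_kernel_kproj bilocal_kernel_Xund wf)
qed (auto intro: bilocal_kernel_kproj bilocal_kernel_kadd bilocal_kernel_ksmul bilocal_kernel_kmult
    bilocal_kernel_kadj wf)

theorem theorem3p2:
  fixes V :: "'v set" and Ed :: "'e set" and ends :: "'e \<Rightarrow> 'v set"
    and \<mu> :: "'v \<Rightarrow> real" and n :: nat and x :: "nat \<Rightarrow> nat \<Rightarrow> ('v,'e) kern"
  assumes "graph_wf V Ed ends"
    and "graph_connected V Ed ends"
    and "\<forall>v\<in>V. \<mu> v > 0"
    and "n \<ge> 1"
    and "\<forall>i<n. \<forall>j<n. x i j \<in> Aalg V Ed ends \<mu>"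
    and "\<forall>i<n. \<forall>j<n. x j i = kadj (x i j)"
  shows "algebraic_fps (cauchy_fps (moment V Ed ends \<mu> n x))"
proof -
  note wf = assms(1)
  \<comment> \<open>The walks below follow rows of \<open>x\<close>, and up to conjugation a row of
    \<open>x i j\<close> is a column of its adjoint.\<close>
  have "\<exists>N. local_kernel V Ed ends N (kadj (x i j))" if "i < n" "j < n" for i j
    using bilocal_kernel_Aalg[OF wf] assms(5) that unfolding bilocal_kernel_def by blast
  then obtain N0 where N0: "\<And>i j. i < n \<Longrightarrow> j < n \<Longrightarrow> local_kernel V Ed ends (N0 i j) (kadj (x i j))"
    by metis
  \<comment> \<open>A common radius for all entries; \<open>Suc\<close> makes it positive, so that
    the empty stack counts as short.\<close>
  define N where "N = Suc (\<Sum>i<n. \<Sum>j<n. N0 i j)"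
  have loc: "local_kernel V Ed ends N (kadj (x i j))" if "i < n" "j < n" for i j
  proof (rule local_kernel_mono[OF N0[OF that]])
    have "N0 i j \<le> (\<Sum>j<n. N0 i j)"
      using that by (intro member_le_sum) auto
    also have "\<dots> \<le> (\<Sum>i<n. \<Sum>j<n. N0 i j)"
      using that by (intro member_le_sum[of i _ "\<lambda>i. \<Sum>j<n. N0 i j"]) auto
    finally show "N0 i j \<le> N"
      by (simp add: N_def)
  qed
  \<comment> \<open>The control state is a matrix index with the start vertex of the path; the stack
    holds the edges, the first one on top. Paths of length 0 thus become empty stacks.\<close>
  define W where "W = {((i, v), l) | i v l. i < n \<and> valid_path V Ed ends (v, l)}"
  \<comment> \<open>The transpose of \<open>x\<close>: expanding \<open>x ^ (k + 1)\<close> as \<open>x * x ^ k\<close> then follows the walk from its start.\<close>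
  define K where "K = (\<lambda>((j, v'), l') ((i, v), l).
    if i < n \<and> j < n then x i j (v, l) (v', l') else 0)"
  have K_nz: "i < n \<and> j < n \<and> kadj (x i j) (v', l') (v, l) \<noteq> 0"
    if "K ((j, v'), l') ((i, v), l) \<noteq> 0" for i j v v' l l'
    using that by (auto simp: K_def kadj_def split: if_splits)
  interpret pushdown W K N
  proof
    fix m
    have "{w \<in> W. length (snd w) \<le> m} \<subseteq>
        (\<lambda>(i, v, l). ((i, v), l)) ` ({..<n} \<times> {w. valid_path V Ed ends w \<and> length (snd w) \<le> m})"
      by (force simp: W_def)
    then show "finite {w \<in> W. length (snd w) \<le> m}"
      using finite_valid_path_bounded[OF wf, of m] by (auto intro: finite_subset)
  next
    fix w w' assume *: "K w' w \<noteq> 0"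
    obtain j v' l' i v l where [simp]: "w' = ((j, v'), l')" "w = ((i, v), l)"
      by (metis surj_pair)
    note nz = K_nz[OF *[simplified]]
    show "w' \<in> W" "length (snd w') \<le> length (snd w) + N"
      using local_kernelD(1,3)[OF loc, of i j "(v', l')" "(v, l)"] nz by (auto simp: W_def)
  next
    fix l s :: "('e \<times> 'v) list" and p l' q assume *: "N \<le> length l" "K (p, l') (q, l @ s) \<noteq> 0"
    then show "\<exists>l''. l' = l'' @ s"
      using K_nz[of "fst p" "snd p" l' "fst q" "snd q" "l @ s"]
        local_kernelD(5)[OF loc, of "fst q" "fst p" l] by auto
  next
    fix l s :: "('e \<times> 'v) list" and p l' q assume *: "N \<le> length l" "(q, l @ s) \<in> W"
    have "kadj (x i j) (v', l' @ s) (v, l @ s) = kadj (x i j) (v', l') (v, l)"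
      if "i < n" "j < n" "q = (i, v)" for i j v v'
      using that * by (intro local_kernelD(6)[OF loc]) (auto simp: W_def)
    then show "K (p, l' @ s) (q, l @ s) = K (p, l') (q, l)"
      by (auto simp: K_def kadj_def split: prod.splits)
  qed (auto simp: W_def dest: valid_path_prefix[OF wf])
  \<comment> \<open>Coefficient \<open>k\<close> collects the walks of length \<open>k\<close> from
    the second argument to the first.\<close>
  define G where "G = (\<lambda>((i, a), l) ((j, v), r). Abs_fps (\<lambda>k. mat_pow V Ed ends n x k j i (v, r) (a, l)))"
  define T :: "((nat \<times> 'v) \<times> ('e \<times> 'v) list) set" where "T = (\<lambda>p. (p, [])) ` ({..<n} \<times> V)"
  define c where "c p = complex_of_real (\<mu> (snd (fst p))) / of_nat n" for p :: "(nat \<times> 'v) \<times> ('e \<times> 'v) list"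
  have step: "mat_mult n x P j i w u = (\<Sum>m<n. \<Sum>w' | x j m w w' \<noteq> 0. x j m w w' * P m i w' u)"
    if "j < n" for P :: "nat \<Rightarrow> nat \<Rightarrow> ('v, 'e) kern" and i j w u
    unfolding mat_mult_def
  proof (rule sum.cong)
    fix m assume "m \<in> {..<n}"
    then have "finite {w'. x j m w w' \<noteq> 0}"
      using finite_local_kernel_support[OF wf loc, of j m w] that by (simp add: kadj_def)
    then show "kmult (x j m) (P m i) w u = (\<Sum>w' | x j m w w' \<noteq> 0. x j m w w' * P m i w' u)"
      unfolding kmult_def by (rule infsum_finite_support) auto
  qed simp
  have K_eq: "K ((m, a), l) ((j, v), r) = x j m (v, r) (a, l)" if "j < n" "m < n" for j m a l v r
    using that by (simp add: K_def)
  have mem_nexts: "((m, a), l) \<in> nexts ((j, v), r) \<longleftrightarrow> m < n \<and> x j m (v, r) (a, l) \<noteq> 0"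
    if "j < n" for j m a l v r
    unfolding nexts_def mem_Collect_eq using that by (simp add: K_def)
  have nexts: "(\<Sum>w\<in>nexts ((j, v), r). K w ((j, v), r) * h w) =
      (\<Sum>m<n. \<Sum>w' | x j m (v, r) w' \<noteq> 0. x j m (v, r) w' * h ((m, fst w'), snd w'))"
    if "j < n" for j v r and h :: "(nat \<times> 'v) \<times> ('e \<times> 'v) list \<Rightarrow> complex"
  proof -
    let ?f = "\<lambda>(m :: nat, w' :: ('v, 'e) fpath). ((m, fst w'), snd w')"
    let ?S = "SIGMA m:{..<n}. {w'. x j m (v, r) w' \<noteq> 0}"
    have "nexts ((j, v), r) = ?f ` ?S"
    proof (intro equalityI subsetI)
      fix w assume w: "w \<in> nexts ((j, v), r)"
      obtain m a l where "w = ((m, a), l)"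
        by (metis surj_pair)
      then show "w \<in> ?f ` ?S"
        using w that by (intro image_eqI[of _ _ "(m, a, l)"]) (auto simp: mem_nexts)
    next
      fix w assume "w \<in> ?f ` ?S"
      then show "w \<in> nexts ((j, v), r)"
        using that by (auto simp: mem_nexts)
    qed
    moreover have "inj_on ?f ?S"
      by (auto simp: inj_on_def)
    moreover have "finite {w'. x j m (v, r) w' \<noteq> 0}" if "m < n" for m
      using finite_local_kernel_support[OF wf loc, of j m "(v, r)"] that \<open>j < n\<close> by (simp add: kadj_def)
    ultimately show ?thesis
      using that by (subst sum.Sigma) (auto simp: sum.reindex K_eq intro!: sum.cong)
  qed
  have rec: "G a v = fps_const (if v = a then 1 else 0) +
      fps_X * (\<Sum>w\<in>nexts v. fps_const (K w v) * G a w)" if av: "a \<in> T" "v \<in> W" for a v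
  proof (rule fps_ext)
    obtain i b where a: "a = ((i, b), [])" "i < n" "b \<in> V"
      using av by (auto simp: T_def)
    obtain j d r where v: "v = ((j, d), r)" "j < n"
      using av by (auto simp: W_def)
    have G: "fps_nth (G a w) k = mat_pow V Ed ends n x k (fst (fst w)) i (snd (fst w), snd w) (b, [])" for w k
      by (auto simp: G_def a split: prod.splits)
    fix k
    show "fps_nth (G a v) k = fps_nth (fps_const (if v = a then 1 else 0) +
        fps_X * (\<Sum>w\<in>nexts v. fps_const (K w v) * G a w)) k"
    proof (cases k)
      case 0
      have "fps_nth (G a v) k = (if v = a then 1 else 0)"
        unfolding G 0 using a v by (auto simp: mat_one_def kid_def kzero_def valid_path_def)
      then show ?thesis
        by (simp add: 0)
    next
      case (Suc k')
      have "fps_nth (G a v) k = (\<Sum>w\<in>nexts v. K w v * fps_nth (G a w) k')"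
        unfolding v Suc using v by (simp add: nexts step G)
      then show ?thesis
        by (simp add: Suc fps_sum_nth)
    qed
  qed
  \<comment> \<open>The closed walks at the states in \<open>T\<close> give the trace, and the
    factor X matches the shift in \<open>cauchy_fps\<close>, where moment \<open>k\<close> has
    exponent \<open>k + 1\<close>.\<close>
  have "cauchy_fps (moment V Ed ends \<mu> n x) = fps_X * (\<Sum>a\<in>T. fps_const (c a) * G a a)"
  proof (rule fps_ext)
    fix k
    have "inj_on (\<lambda>p. (p, [] :: ('e \<times> 'v) list)) ({..<n} \<times> V)"
      by (auto simp: inj_on_def)
    then have "fps_nth (\<Sum>a\<in>T. fps_const (c a) * G a a) k = moment V Ed ends \<mu> n x k" for k
      by (simp add: T_def sum.reindex fps_sum_nth G_def c_def moment_def Trace_def sum_distrib_left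
          sum.cartesian_product case_prod_unfold)
    then show "fps_nth (cauchy_fps (moment V Ed ends \<mu> n x)) k =
        fps_nth (fps_X * (\<Sum>a\<in>T. fps_const (c a) * G a a)) k"
      by (cases k) (simp_all add: cauchy_fps_def)
  qed
  moreover have T: "finite T" "T \<subseteq> short"
    unfolding short_def using wf by (auto simp: T_def graph_wf_def W_def valid_path_def N_def)
  ultimately show ?thesis
    unfolding algebraic_fps_def using walk_gf_algebraic[OF T rec, where \<mu> = c] by simp
qed

end
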